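(* Let $Z$ be a bounded metric space with finite capacity dimension $\operatorname{cdim}Z=n<\infty$. Then there exist metric trees $T_a$, $a\in A$, $|A|=n+1$, and a quasi-isometric embedding $f:\operatorname{Co}(Z)\to\prod_{a\in A}T_a$.
   Context: Hyperbolic cone: for a bounded metric space $Z$ with $\operatorname{diam}Z>0$, put $\mu=\pi/\operatorname{diam}Z$. $\operatorname{Co}(Z)=Z\times[0,\infty)/Z\times\{0\}$, with metric: for $x=(z,t)$, $x'=(z',t')$, $|xx'|$ is the length of the side $\bar x\bar x'$ of a triangle $\bar o\bar x\bar x'$ in the hyperbolic plane $\mathrm H^2$ with $|\bar o\bar x|=t$, $|\bar o\bar x'|=t'$ and angle $\mu|zz'|$ at $\bar o$. If $Z$ is a point, $\operatorname{Co}(Z)=[0,\infty)$. A map $f$ is a quasi-isometric embedding if $\frac1\Lambda|xx'|-\sigma\le|f(x)f(x')|\le\Lambda|xx'|+\sigma$ for some $\Lambda\ge1,\sigma\ge0$. Metric tree: geodesic real tree. Products carry the $\ell^2$ product metric. Capacity dimension: with $\operatorname{mesh}(\mathcal U)=\sup_{U\in\mathcal U}\operatorname{diam}U$, an open covering $\mathcal U$ being $(m+1)$-colored if it is a union of $m+1$ subfamilies each consisting of pairwise disjoint sets, and Lebesgue number $L(\mathcal U)=\inf_{z}\min\{\sup_{U\in\mathcal U}\operatorname{dist}(z,Z\setminus U),\operatorname{mesh}\mathcal U\}$, $\operatorname{cdim}(Z)$ is the least integer $m\ge0$ for which there is $\delta>0$ such that for all sufficiently small $\tau>0$ there is an open $(m+1)$-colored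 covering $\mathcal U$ of $Z$ with $\operatorname{mesh}(\mathcal U)\le\tau$ and $L(\mathcal U)\ge\delta\tau$. *)

theory Defs
  imports "HOL-Analysis.Analysis" "HOL-Library.Extended_Nat" "HOL-Library.Extended_Real"
begin

text \<open>Points of Co(Z) are represented by pairs (z,t) with z in Z and t >= 0; the
  distance below is the hyperbolic law of cosines (side opposite to the angle
  mu*|zz'| in a triangle of H^2 with adjacent sides t, t'), mu = pi / diam Z.
  All pairs (z,0) are at distance 0 from each other, so this is a pseudometric
  whose metric quotient is Co(Z).  If diam Z = 0 (Z a point) then mu*|zz'| = 0
  and the formula gives |t - t'|, i.e. Co(Z) = [0,oo).\<close>

definition cone_angle :: "'a::metric_space set \<Rightarrow> 'a \<Rightarrow> 'a \<Rightarrow> real" where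
  "cone_angle Z z z' = (if diameter Z = 0 then 0 else (pi / diameter Z) * dist z z')"

definition cone_dist :: "'a::metric_space set \<Rightarrow> 'a \<times> real \<Rightarrow> 'a \<times> real \<Rightarrow> real" where
  "cone_dist Z x x' =
     arcosh (cosh (snd x) * cosh (snd x') - sinh (snd x) * sinh (snd x') * cos (cone_angle Z (fst x) (fst x')))"

definition cone_carrier :: "'a set \<Rightarrow> ('a \<times> real) set" where
  "cone_carrier Z = Z \<times> {0..}"

definition geodesic_segment :: "'b set \<Rightarrow> ('b \<Rightarrow> 'b \<Rightarrow> real) \<Rightarrow> 'b \<Rightarrow> 'b \<Rightarrow> (real \<Rightarrow> 'b) \<Rightarrow> bool" where
  "geodesic_segment T d x y \<gamma> \<longleftrightarrow>
     \<gamma> 0 = x \<and> \<gamma> (d x y) = y \<and>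
     (\<forall>s\<in>{0..d x y}. \<forall>s'\<in>{0..d x y}. \<gamma> s \<in> T \<and> d (\<gamma> s) (\<gamma> s') = \<bar>s - s'\<bar>)"

definition arc_in :: "'b set \<Rightarrow> ('b \<Rightarrow> 'b \<Rightarrow> real) \<Rightarrow> 'b \<Rightarrow> 'b \<Rightarrow> (real \<Rightarrow> 'b) \<Rightarrow> bool" where
  "arc_in T d x y p \<longleftrightarrow>
     pathin (Metric_space.mtopology T d) p \<and> inj_on p {0..1} \<and> p 0 = x \<and> p 1 = y"

definition metric_tree :: "'b set \<Rightarrow> ('b \<Rightarrow> 'b \<Rightarrow> real) \<Rightarrow> bool" where
  "metric_tree T d \<longleftrightarrow> Metric_space T d \<and>
     (\<forall>x\<in>T. \<forall>y\<in>T. (\<exists>\<gamma>. geodesic_segment T d x y \<gamma>) \<and>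
        (\<forall>\<gamma> p. geodesic_segment T d x y \<gamma> \<and> arc_in T d x y p \<longrightarrow>
                 p ` {0..1} = \<gamma> ` {0..d x y}))"

definition qi_embedding ::
  "'c set \<Rightarrow> ('c \<Rightarrow> 'c \<Rightarrow> real) \<Rightarrow> ('d \<Rightarrow> 'd \<Rightarrow> real) \<Rightarrow> ('c \<Rightarrow> 'd) \<Rightarrow> bool" where
  "qi_embedding X dX dY f \<longleftrightarrow>
     (\<exists>\<Lambda> \<sigma>. \<Lambda> \<ge> 1 \<and> \<sigma> \<ge> 0 \<and>
        (\<forall>x\<in>X. \<forall>x'\<in>X. dX x x' / \<Lambda> - \<sigma> \<le> dY (f x) (f x') \<and> dY (f x) (f x') \<le> \<Lambda> * dX x x' + \<sigma>))"

definition l2_prod_dist :: "'i set \<Rightarrow> ('i \<Rightarrow> 'b \<Rightarrow> 'b \<Rightarrow> real) \<Rightarrow> ('i \<Rightarrow> 'b) \<Rightarrow> ('i \<Rightarrow> 'b) \<Rightarrow> real" where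
  "l2_prod_dist A d x y = sqrt (\<Sum>a\<in>A. (d a (x a) (y a))\<^sup>2)"

definition mesh :: "'a::metric_space set set \<Rightarrow> ereal" where
  "mesh \<U> = (SUP U\<in>\<U>. ereal (diameter U))"

text \<open>dist(z, Z - U), with the convention inf of the empty set = +oo.\<close>
definition setdist_e :: "'a::metric_space \<Rightarrow> 'a set \<Rightarrow> ereal" where
  "setdist_e z S = (INF y\<in>S. ereal (dist z y))"

definition lebesgue_number :: "'a::metric_space set \<Rightarrow> 'a set set \<Rightarrow> ereal" where
  "lebesgue_number Z \<U> = (INF z\<in>Z. min (SUP U\<in>\<U>. setdist_e z (Z - U)) (mesh \<U>))"

definition open_covering :: "'a::metric_space set \<Rightarrow> 'a set set \<Rightarrow> bool" where
  "open_covering Z \<U> \<longleftrightarrow> (\<forall>U\<in>\<U>. openin (top_of_set Z) U) \<and> Z \<subseteq> \<Union>\<U>"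

definition colored :: "nat \<Rightarrow> 'a set set \<Rightarrow> bool" where
  "colored k \<U> \<longleftrightarrow> (\<exists>\<F>::nat \<Rightarrow> 'a set set. \<U> = (\<Union>i<k. \<F> i) \<and>
      (\<forall>i<k. pairwise disjnt (\<F> i)))"

definition cdim_witness :: "'a::metric_space set \<Rightarrow> nat \<Rightarrow> bool" where
  "cdim_witness Z m \<longleftrightarrow> (\<exists>\<delta>>0. \<exists>\<tau>0>0. \<forall>\<tau>. 0 < \<tau> \<and> \<tau> \<le> \<tau>0 \<longrightarrow>
      (\<exists>\<U>. open_covering Z \<U> \<and> colored (Suc m) \<U> \<and> mesh \<U> \<le> ereal \<tau> \<and>
            lebesgue_number Z \<U> \<ge> ereal (\<delta> * \<tau>)))"

definition cdim :: "'a::metric_space set \<Rightarrow> enat" where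
  "cdim Z = (if \<exists>m. cdim_witness Z m then enat (LEAST m. cdim_witness Z m) else \<infinity>)"

end

theory Submission
  imports Defs
begin

text \<open>
  For every colour \<open>a\<close> and every scale \<open>t\<^sub>i = t\<^sub>0 r\<^sup>i\<close>, capacity dimension \<open>n\<close> gives a family of sets
  of diameter at most \<open>t\<^sub>i\<close> which are separated by a definite multiple of \<open>t\<^sub>i\<close>, such that the
  \<open>n + 1\<close> families of one scale cover \<open>Z\<close>.  Fix a colour.  Thickening the sets and merging those of
  level at least \<open>j\<close> that meet yields nested equivalence relations whose classes still have diameter
  at most \<open>2 t\<^sub>j\<close>.  Give every \<open>z\<close> a ray on which one unit of length is spent for each level at
  which \<open>z\<close> lies (almost) in a set of the family, and glue two rays as long as these sets agree;
  the result is a tree, and \<open>(z, t)\<close> is sent to the point of the ray of \<open>z\<close> reached at level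
  \<open>t / ln (1/r)\<close>.  Two points of \<open>Z\<close> at distance about \<open>t\<^sub>m\<close> agree, up to at most one level, before
  level \<open>m\<close> and disagree after it, so no tree distance exceeds \<open>k + k' - 2 min k k' m\<close> by more than
  a constant.  As every level is counted in some colour, the sum of the tree distances is at least
  half of this quantity, up to a constant.  In the cone the distance is \<open>ln (1/r)\<close> times the same
  quantity, up to a constant, by the hyperbolic law of cosines.
\<close>

section \<open>Geodesic spaces with the four-point condition\<close>

text \<open>Along an arc, the projection to a geodesic with the same end points can only change while the
  arc is on the geodesic; an excursion would therefore return to its starting point.\<close>

lemma locally_constant_excursion:
  fixes \<phi> e :: "real \<Rightarrow> real"
  assumes cphi: "continuous_on {0..1} \<phi>" and ce: "continuous_on {0..1} e"
    and e0: "e 0 = 0" and e1: "e 1 = 0"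
    and loc: "\<And>v. v \<in> {0..1} \<Longrightarrow> e v \<noteq> 0 \<Longrightarrow> \<forall>\<^sub>F w in at v within {0..1}. \<phi> w = \<phi> v"
    and u: "u \<in> {0..1}" "e u \<noteq> 0"
  obtains a b where "0 \<le> a" "a < b" "b \<le> 1" "e a = 0" "e b = 0" "\<phi> a = \<phi> b"
proof -
  have c1: "closed ({0..u} \<inter> e -` {0})" and c2: "closed ({u..1} \<inter> e -` {0})"
    using u by (auto intro!: continuous_closed_preimage continuous_on_subset[OF ce])
  have k: "compact ({0..u} \<inter> e -` {0})" "compact ({u..1} \<inter> e -` {0})"
    using c1 c2 by (auto simp: compact_eq_bounded_closed intro: bounded_subset[OF bounded_closed_interval])
  have ne: "{0..u} \<inter> e -` {0} \<noteq> {}" "{u..1} \<inter> e -` {0} \<noteq> {}"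
    using u e0 e1 by (auto simp: ex_in_conv[symmetric] simp del: ex_in_conv)
  \<comment> \<open>\<open>a\<close> is the last zero of \<open>e\<close> before \<open>u\<close>
    and \<open>b\<close> the first one after it, so \<open>e\<close> does not vanish strictly
    between them and \<open>\<phi>\<close> is locally constant there.\<close>
  obtain a where a: "a \<in> {0..u} \<inter> e -` {0}" "\<And>v. v \<in> {0..u} \<inter> e -` {0} \<Longrightarrow> v \<le> a"
    using compact_attains_sup[OF k(1) ne(1)] by blast
  obtain b where b: "b \<in> {u..1} \<inter> e -` {0}" "\<And>v. v \<in> {u..1} \<inter> e -` {0} \<Longrightarrow> b \<le> v"
    using compact_attains_inf[OF k(2) ne(2)] by blast
  have ab: "0 \<le> a" "a < b" "b \<le> 1" "e a = 0" "e b = 0"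
    using a b u by (auto simp: less_le)
  have "\<phi> b = \<phi> a"
  proof (rule DERIV_isconst_end[OF \<open>a < b\<close>])
    show "continuous_on {a..b} \<phi>"
      using ab by (auto intro: continuous_on_subset[OF cphi])
    fix x assume x: "a < x" "x < b"
    then have "e x \<noteq> 0" using a(2)[of x] b(2)[of x] ab by force
    moreover have "x \<in> interior {0..1}" using x ab by (simp add: interior_atLeastAtMost_real)
    ultimately have "\<forall>\<^sub>F w in at x. \<phi> w = \<phi> x"
      using loc[of x] x ab at_within_interior[of x "{0..1}"] by auto
    then have "\<forall>\<^sub>F w in nhds x. \<phi> w = \<phi> x"
      by (simp add: eventually_nhds_conv_at)
    then show "DERIV \<phi> x :> 0"
      by (subst DERIV_cong_ev[OF refl _ refl, of _ "\<lambda>_. \<phi> x"]) auto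
  qed
  with ab that show thesis by metis
qed

text \<open>The four-point condition puts \<open>w\<close> within \<open>e w\<close> of its
  projection \<open>\<gamma> (\<phi> w)\<close> and makes \<open>\<phi>\<close> constant on the ball
  of radius \<open>e w\<close> about \<open>w\<close>. An arc leaving the segment would thus return
  to the point where it left, against injectivity; the intermediate value theorem shows that it
  covers the segment.\<close>

theorem four_point_metric_tree:
  assumes "Metric_space T d"
    and four: "\<And>x y z w. x \<in> T \<Longrightarrow> y \<in> T \<Longrightarrow> z \<in> T \<Longrightarrow> w \<in> T \<Longrightarrow>
        d x y + d z w \<le> max (d x z + d y w) (d x w + d y z)"
    and geo: "\<And>x y. x \<in> T \<Longrightarrow> y \<in> T \<Longrightarrow> \<exists>\<gamma>. geodesic_segment T d x y \<gamma>"
  shows "metric_tree T d"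
  unfolding metric_tree_def
proof (intro conjI ballI allI impI; (elim conjE)?)
  interpret M: Metric_space T d by fact
  show "Metric_space T d" by fact
  fix x y assume x: "x \<in> T" and y: "y \<in> T"
  show "\<exists>\<gamma>. geodesic_segment T d x y \<gamma>" by (fact geo[OF x y])
  fix \<gamma> p assume g: "geodesic_segment T d x y \<gamma>" and arc: "arc_in T d x y p"
  \<comment> \<open>These are Gromov products: \<open>\<phi> w\<close> is that of \<open>w\<close>
    and \<open>y\<close> seen from \<open>x\<close>, and \<open>e w\<close> that of \<open>x\<close>
    and \<open>y\<close> seen from \<open>w\<close>.\<close>
  define \<phi> where "\<phi> w = (d x w + d x y - d w y) / 2" for w
  define e where "e w = (d x w + d w y - d x y) / 2" for w
  have g0: "\<gamma> 0 = x" "\<gamma> (d x y) = y" and gT: "\<And>s. s \<in> {0..d x y} \<Longrightarrow> \<gamma> s \<in> T"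
    and gd: "\<And>s s'. s \<in> {0..d x y} \<Longrightarrow> s' \<in> {0..d x y} \<Longrightarrow> d (\<gamma> s) (\<gamma> s') = \<bar>s - s'\<bar>"
    using g by (auto simp: geodesic_segment_def)
  have phi_range: "\<phi> w \<in> {0..d x y}" if "w \<in> T" for w
    using M.triangle[OF that x y] M.triangle[OF x that y] M.triangle[OF x y that] M.commute[of w x] M.commute[of w y]
    by (auto simp: \<phi>_def)
  have proj: "d w (\<gamma> (\<phi> w)) \<le> e w" if w: "w \<in> T" for w
  proof -
    have "d w (\<gamma> (\<phi> w)) + d x y \<le> max (d w x + d (\<gamma> (\<phi> w)) y) (d w y + d (\<gamma> (\<phi> w)) x)"
      by (rule four[OF w gT[OF phi_range[OF w]] x y])
    moreover have "d (\<gamma> (\<phi> w)) x = \<phi> w" "d (\<gamma> (\<phi> w)) y = d x y - \<phi> w"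
      using gd[of "\<phi> w" 0] gd[of "\<phi> w" "d x y"] phi_range[OF w] g0 by auto
    ultimately show ?thesis
      by (simp add: \<phi>_def e_def M.commute[of w x] field_simps)
  qed
  have on_seg: "w = \<gamma> (\<phi> w)" if "w \<in> T" "e w = 0" for w
    using proj[OF that(1)] gT[OF phi_range[OF that(1)]] that M.nonneg[of w "\<gamma> (\<phi> w)"]
    by (metis M.zero order_antisym)
  have phi_loc: "\<phi> w' = \<phi> w" if w: "w \<in> T" "w' \<in> T" "d w w' < e w" for w w'
  proof -
    have "d w x + d w' y \<le> max (d w w' + d x y) (d w y + d x w')"
      "d w y + d w' x \<le> max (d w w' + d y x) (d w x + d y w')"
      "0 \<le> e w'"
      using four[OF w(1) x w(2) y] four[OF w(1) y w(2) x] M.triangle[OF x w(2) y] by (auto simp: e_def)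
    moreover have "d w x = d x w" "d w' x = d x w'" "d y x = d x y" "d y w' = d w' y"
      by (rule M.commute)+
    \<comment> \<open>If both cross sums \<open>a + b'\<close> and \<open>b + a'\<close> are at most
      \<open>c + D\<close>, adding them contradicts the last two assumptions. If only one is, the
      bound on the other fails. So both exceed \<open>c + D\<close> and bound each other.\<close>
    moreover have "a' - b' = a - b" if "a + b' \<le> max (c + D) (b + a')" "b + a' \<le> max (c + D) (a + b')"
      "0 \<le> (a' + b' - D) / 2" "c < (a + b - D) / 2" for a b a' b' c D :: real
      using that by (cases "a + b' \<le> c + D"; cases "b + a' \<le> c + D") (auto simp: le_max_iff_disj field_simps)
    ultimately have "d x w' - d w' y = d x w - d w y"
      using w(3) unfolding e_def by (metis (no_types))
    then show ?thesis by (simp add: \<phi>_def)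
  qed
  have p: "continuous_map (top_of_set {0..1}) M.mtopology p" "inj_on p {0..1}" "p 0 = x" "p 1 = y"
    using arc by (auto simp: arc_in_def pathin_def)
  have pT: "p u \<in> T" if "u \<in> {0..1}" for u
    using continuous_map_image_subset_topspace[OF p(1)] that by auto
  have cd: "continuous_on {0..1} (\<lambda>u. d (p u) z)" if z: "z \<in> T" for z
  proof -
    have "continuous_map (top_of_set {0..1}) euclidean (\<lambda>u. mdist (metric(T,d)) (p u) z)"
      using p(1) z by (intro continuous_map_mdist) (auto simp: mtopology_of_def)
    then show ?thesis by simp
  qed
  have cphi: "continuous_on {0..1} (\<lambda>u. \<phi> (p u))" and ce: "continuous_on {0..1} (\<lambda>u. e (p u))"
    unfolding \<phi>_def e_def by (auto intro!: continuous_intros cd[OF y] cd[OF x] simp: M.commute[of x "p _"])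
  have ends: "e (p 0) = 0" "e (p 1) = 0" "\<phi> (p 0) = 0" "\<phi> (p 1) = d x y"
    using x y by (simp_all add: e_def \<phi>_def p)
  have e0: "e (p u) = 0" if u: "u \<in> {0..1}" for u
  proof (rule ccontr)
    assume "e (p u) \<noteq> 0"
    have loc: "\<forall>\<^sub>F w in at v within {0..1}. \<phi> (p w) = \<phi> (p v)" if v: "v \<in> {0..1}" "e (p v) \<noteq> 0" for v
    proof -
      have "0 < e (p v)" using v M.triangle[OF x pT[OF v(1)] y] by (auto simp: e_def)
      moreover have "((\<lambda>u. d (p u) (p v)) \<longlongrightarrow> d (p v) (p v)) (at v within {0..1})"
        using cd[OF pT[OF v(1)]] v(1) by (simp add: continuous_on_def)
      ultimately have "\<forall>\<^sub>F w in at v within {0..1}. d (p w) (p v) < e (p v)"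
        using pT[OF v(1)] by (intro order_tendstoD(2)) auto
      moreover have "\<forall>\<^sub>F w in at v within {0..1}. w \<in> {0..1}"
        by (auto simp: eventually_at_filter)
      ultimately show ?thesis
        by eventually_elim (rule phi_loc, use v(1) pT M.commute[of "p v"] in auto)
    qed
    obtain a b where ab: "0 \<le> a" "a < b" "b \<le> 1" "e (p a) = 0" "e (p b) = 0" "\<phi> (p a) = \<phi> (p b)"
      by (rule locally_constant_excursion[OF cphi ce ends(1,2) loc u \<open>e (p u) \<noteq> 0\<close>]) auto
    then have "p a = p b" using on_seg[of "p a"] on_seg[of "p b"] pT by auto
    with ab p(2) show False by (auto dest: inj_onD)
  qed
  show "p ` {0..1} = \<gamma> ` {0..d x y}"
  proof (intro equalityI subsetI)
    fix w assume "w \<in> p ` {0..1}"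
    then show "w \<in> \<gamma> ` {0..d x y}" using on_seg e0 pT phi_range by (metis image_iff)
  next
    fix w assume "w \<in> \<gamma> ` {0..d x y}"
    then obtain s where s: "0 \<le> s" "s \<le> d x y" "w = \<gamma> s" by auto
    obtain u where "0 \<le> u" "u \<le> 1" "\<phi> (p u) = s"
      using IVT'[of "\<lambda>u. \<phi> (p u)" 0 s 1] s ends cphi by auto
    moreover have "w = p u" using on_seg[of "p u"] e0[of u] pT[of u] s calculation by auto
    ultimately show "w \<in> p ` {0..1}" by auto
  qed
qed

section \<open>Trees obtained by gluing rays\<close>

text \<open>The rays of \<open>x\<close> and \<open>y\<close> coincide up to height \<open>g x y\<close>; the value \<open>g x x\<close> is ignored.\<close>

locale ray_gluing =
  fixes g :: "'a \<Rightarrow> 'a \<Rightarrow> real"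
  assumes g_nonneg: "0 \<le> g x y"
    and g_sym: "g x y = g y x"
    and g_ultra: "x \<noteq> y \<Longrightarrow> y \<noteq> z \<Longrightarrow> x \<noteq> z \<Longrightarrow> min (g x y) (g y z) \<le> g x z"
begin

text \<open>The Gromov product of two points based at the common root: the height at which their
  paths from the root separate.\<close>

definition meet :: "'a \<times> real \<Rightarrow> 'a \<times> real \<Rightarrow> real" where
  "meet x y = (if fst x = fst y then min (snd x) (snd y) else min (min (snd x) (snd y)) (g (fst x) (fst y)))"

definition ray_dist :: "'a \<times> real \<Rightarrow> 'a \<times> real \<Rightarrow> real" where
  "ray_dist x y = snd x + snd y - 2 * meet x y"

definition rays :: "('a \<times> real) set" where
  "rays = UNIV \<times> {0..}"

text \<open>One point is chosen from each class at distance zero, so that the quotient is again a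
  set of pairs.\<close>

definition rep :: "'a \<times> real \<Rightarrow> 'a \<times> real" where
  "rep x = (SOME y. y \<in> rays \<and> ray_dist x y = 0)"

lemma meet_sym: "meet x y = meet y x"
  by (auto simp: meet_def g_sym[of "fst x"] min.commute)

lemma meet_ultra: "meet x z \<ge> meet x y \<or> meet x z \<ge> meet y z"
proof (cases "fst x = fst y \<or> fst y = fst z \<or> fst x = fst z")
  case True
  then show ?thesis by (elim disjE) (auto simp: meet_def g_sym[of "fst x"] min_def)
next
  case False
  then show ?thesis using g_ultra[of "fst x" "fst y" "fst z"] by (simp add: meet_def) linarith
qed

lemma ray_dist_nonneg: "0 \<le> ray_dist x y"
  by (auto simp: ray_dist_def meet_def min_def)

lemma ray_dist_sym: "ray_dist x y = ray_dist y x"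
  by (simp add: ray_dist_def meet_sym[of x y])

lemma ray_dist_refl [simp]: "ray_dist x x = 0"
  by (simp add: ray_dist_def meet_def)

text \<open>The heights contribute the same total to all three sums, which leaves an inequality
  between meeting heights; it follows from the ultrametric inequality.\<close>

lemma ray_dist_four_point:
  "ray_dist x y + ray_dist z w \<le> max (ray_dist x z + ray_dist y w) (ray_dist x w + ray_dist y z)"
proof -
  have "meet x y + meet z w \<ge> min (meet x z + meet y w) (meet x w + meet y z)"
    using meet_ultra[of x z y] meet_ultra[of x w y] meet_ultra[of z x w] meet_ultra[of z y w]
      meet_sym[of x z] meet_sym[of y z] meet_sym[of y w] meet_sym[of x w]
    by linarith
  then show ?thesis unfolding ray_dist_def by linarith
qed

lemma ray_dist_triangle: "ray_dist x z \<le> ray_dist x y + ray_dist y z"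
  using ray_dist_four_point[of x z y y] by (simp add: ray_dist_sym)

lemma rep: "x \<in> rays \<Longrightarrow> rep x \<in> rays \<and> ray_dist x (rep x) = 0"
  unfolding rep_def by (rule someI[of _ x]) simp

lemma ray_dist_zero_cong: "ray_dist x x' = 0 \<Longrightarrow> ray_dist x y = ray_dist x' y"
  using ray_dist_triangle[of x y x'] ray_dist_triangle[of x' y x] by (simp add: ray_dist_sym)

lemma ray_dist_rep:
  assumes "x \<in> rays" "y \<in> rays"
  shows "ray_dist (rep x) (rep y) = ray_dist x y"
  using ray_dist_zero_cong rep assms by (metis ray_dist_sym)

lemma rep_cong: "ray_dist x y = 0 \<Longrightarrow> rep x = rep y"
  unfolding rep_def by (simp add: ray_dist_zero_cong[of x y])

lemma rep_rep: "x \<in> rays \<Longrightarrow> rep (rep x) = rep x"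
  using rep rep_cong by metis

text \<open>The path descends the ray of \<open>x\<close> to the meeting height and climbs that of
  \<open>y\<close>. Its end is only at distance zero from \<open>y\<close>: when \<open>y\<close>
  lies on the common part, the path stops on the ray of \<open>x\<close>.\<close>

lemma ray_geodesic:
  assumes x: "x \<in> rays" and y: "y \<in> rays"
  shows "\<exists>\<gamma>. \<gamma> 0 = x \<and> ray_dist (\<gamma> (ray_dist x y)) y = 0 \<and>
    (\<forall>u\<in>{0..ray_dist x y}. \<forall>v\<in>{0..ray_dist x y}. \<gamma> u \<in> rays \<and> ray_dist (\<gamma> u) (\<gamma> v) = \<bar>u - v\<bar>)"
proof -
  obtain z s z' s' where xy: "x = (z, s)" "y = (z', s')" by fastforce
  have s: "0 \<le> s" "0 \<le> s'" using x y by (auto simp: xy rays_def)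
  define m where "m = meet x y"
  have m: "0 \<le> m" "m \<le> s" "m \<le> s'" "z \<noteq> z' \<Longrightarrow> m \<le> g z z'"
    "m = s \<or> m = s' \<or> z \<noteq> z' \<and> m = g z z'"
    using s g_nonneg[of z z'] by (auto simp: m_def meet_def xy min_def)
  have D: "ray_dist x y = s + s' - 2 * m" by (simp add: ray_dist_def m_def xy)
  define \<gamma> where "\<gamma> u = (if u \<le> s - m then (z, s - u) else (z', u + 2 * m - s))" for u
  have mono: "ray_dist (\<gamma> u) (\<gamma> v) = v - u" if "0 \<le> u" "u \<le> v" "v \<le> s + s' - 2 * m" for u v
    using that m by (auto simp: \<gamma>_def ray_dist_def meet_def min_def)
  have "\<gamma> 0 = x" using m by (simp add: \<gamma>_def xy)
  moreover have "ray_dist (\<gamma> (ray_dist x y)) y = 0"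
    using m by (auto simp: \<gamma>_def D xy ray_dist_def meet_def min_def)
  moreover have "\<gamma> u \<in> rays" if "0 \<le> u" for u
    using that m by (auto simp: \<gamma>_def rays_def)
  moreover have "ray_dist (\<gamma> u) (\<gamma> v) = \<bar>u - v\<bar>" if "u \<in> {0..ray_dist x y}" "v \<in> {0..ray_dist x y}" for u v
    using mono[of u v] mono[of v u] that ray_dist_sym[of "\<gamma> u" "\<gamma> v"] by (cases "u \<le> v") (auto simp: D)
  ultimately show ?thesis by (intro exI[of _ \<gamma>]) auto
qed

theorem metric_tree_rays: "metric_tree (rep ` rays) ray_dist"
proof (rule four_point_metric_tree)
  show "Metric_space (rep ` rays) ray_dist"
  proof (rule Metric_space.intro)
    fix x y assume "x \<in> rep ` rays" "y \<in> rep ` rays"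
    then have "rep x = x" "rep y = y" using rep_rep by auto
    then show "ray_dist x y = 0 \<longleftrightarrow> x = y" using rep_cong[of x y] by auto
  qed (rule ray_dist_nonneg ray_dist_sym ray_dist_triangle)+
  fix x y assume xy: "x \<in> rep ` rays" "y \<in> rep ` rays"
  then have fixed: "x \<in> rays" "y \<in> rays" "rep x = x" "rep y = y" using rep rep_rep by auto
  then obtain \<gamma> where \<gamma>: "\<gamma> 0 = x" "ray_dist (\<gamma> (ray_dist x y)) y = 0"
    "\<And>u v. u \<in> {0..ray_dist x y} \<Longrightarrow> v \<in> {0..ray_dist x y} \<Longrightarrow>
       \<gamma> u \<in> rays \<and> ray_dist (\<gamma> u) (\<gamma> v) = \<bar>u - v\<bar>"
    using ray_geodesic[of x y] by blast
  have "geodesic_segment (rep ` rays) ray_dist x y (rep \<circ> \<gamma>)"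
    unfolding geodesic_segment_def using \<gamma> fixed rep_cong[OF \<gamma>(2)] by (auto simp: ray_dist_rep)
  then show "\<exists>\<gamma>. geodesic_segment (rep ` rays) ray_dist x y \<gamma>" by blast
qed (rule ray_dist_four_point)

end

section \<open>Multiscale separated families\<close>

text \<open>One colour of the construction. The factor 16 exceeds the 4 + 4 + 2 spent in
  \<open>B_unique\<close>, and \<open>r \<le> 1/12\<close> absorbs the error in
  \<open>Q_union_dist\<close>. Note that \<open>r * t i\<close> is the next scale.\<close>

locale hierarchy =
  fixes W :: "nat \<Rightarrow> 'a::metric_space set set" and r t0 :: real
  assumes r: "0 < r" "r \<le> 1/12" and t0: "0 < t0"
    and W_diam: "\<And>i V x y. V \<in> W i \<Longrightarrow> x \<in> V \<Longrightarrow> y \<in> V \<Longrightarrow> dist x y \<le> t0 * r ^ i"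
    and W_sep: "\<And>i V V' x y. V \<in> W i \<Longrightarrow> V' \<in> W i \<Longrightarrow> V \<noteq> V' \<Longrightarrow> x \<in> V \<Longrightarrow> y \<in> V' \<Longrightarrow>
        16 * r * (t0 * r ^ i) < dist x y"
begin

abbreviation t :: "nat \<Rightarrow> real" where "t i \<equiv> t0 * r ^ i"

text \<open>The radius is four times the next scale, twice the diameter bound for classes built from
  finer levels; the excess leaves room for a nearby second point.\<close>

definition B :: "nat \<Rightarrow> 'a set \<Rightarrow> 'a set" where
  "B i V = {y. \<exists>v\<in>V. dist v y \<le> 4 * r * t i}"

definition Q :: "nat \<Rightarrow> ('a \<times> 'a) set" where
  "Q i = {(x, y). \<exists>V\<in>W i. x \<in> B i V \<and> y \<in> B i V}"

definition F :: "nat \<Rightarrow> ('a \<times> 'a) set" where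
  "F j = (\<Union>i\<in>{j..}. Q i)\<^sup>*"

section \<open>Diameters of the merged classes\<close>

lemma t_pos: "0 < t i"
  using r t0 by simp

lemma rt_pos: "0 < r * t i"
  using r t_pos by simp

lemma B_unique:
  assumes "V \<in> W i" "V' \<in> W i" "x \<in> B i V" "y \<in> B i V'" "dist x y \<le> 2 * r * t i"
  shows "V = V'"
proof (rule ccontr)
  assume "V \<noteq> V'"
  obtain v v' where v: "v \<in> V" "v' \<in> V'" "dist v x \<le> 4 * r * t i" "dist v' y \<le> 4 * r * t i"
    using assms by (auto simp: B_def)
  have "dist v v' \<le> dist v x + dist x y + dist v' y"
    using dist_triangle[of v v' x] dist_triangle[of x v' y] by (simp add: dist_commute)
  also have "\<dots> \<le> 10 * (r * t i)" using v assms(5) by (simp add: algebra_simps)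
  also have "\<dots> < 16 * (r * t i)" using rt_pos[of i] by simp
  finally show False using W_sep[OF assms(1,2) \<open>V \<noteq> V'\<close> v(1,2)] by (simp add: algebra_simps)
qed

text \<open>\<open>S\<close> stands for the finer levels. An \<open>S\<close>-chain is too short to
  lead from one thickened set of level \<open>j\<close> to another, so all visits of a chain to
  level \<open>j\<close> are to the same set and can be replaced by a single jump inside it.\<close>

lemma Q_union_rtrancl:
  assumes S: "\<And>x y. (x, y) \<in> S\<^sup>* \<Longrightarrow> dist x y \<le> 2 * r * t j"
    and xy: "(x, y) \<in> (Q j \<union> S)\<^sup>*"
  shows "(x, y) \<in> S\<^sup>* \<or> (\<exists>V\<in>W j. \<exists>u\<in>B j V. \<exists>u'\<in>B j V. (x, u) \<in> S\<^sup>* \<and> (u', y) \<in> S\<^sup>*)"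
  using xy
proof (induction rule: rtrancl_induct)
  case base
  then show ?case by simp
next
  case (step y z)
  from step(2) show ?case
  proof
    assume "(y, z) \<in> S"
    then show ?thesis using step(3) by (meson rtrancl.rtrancl_into_rtrancl)
  next
    assume "(y, z) \<in> Q j"
    then obtain V where V: "V \<in> W j" "y \<in> B j V" "z \<in> B j V" by (auto simp: Q_def)
    from step(3) show ?thesis
    proof
      assume "(x, y) \<in> S\<^sup>*"
      then show ?thesis using V by blast
    next
      assume "\<exists>V\<in>W j. \<exists>u\<in>B j V. \<exists>u'\<in>B j V. (x, u) \<in> S\<^sup>* \<and> (u', y) \<in> S\<^sup>*"
      then obtain V' u u' where V': "V' \<in> W j" "u \<in> B j V'" "u' \<in> B j V'" "(x, u) \<in> S\<^sup>*" "(u', y) \<in> S\<^sup>*"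
        by blast
      then have "V' = V" using B_unique V S by blast
      then show ?thesis using V V' by blast
    qed
  qed
qed

text \<open>Two finer chains cost \<open>2 * r * t j\<close> each, reaching \<open>V\<close> from
  its thickening costs \<open>4 * r * t j\<close> at either end, and crossing \<open>V\<close> costs
  \<open>t j\<close>; the first four add up to at most \<open>t j\<close>.\<close>

lemma Q_union_dist:
  assumes S: "\<And>x y. (x, y) \<in> S\<^sup>* \<Longrightarrow> dist x y \<le> 2 * r * t j"
    and xy: "(x, y) \<in> (Q j \<union> S)\<^sup>*"
  shows "dist x y \<le> 2 * t j"
  using Q_union_rtrancl[OF S xy]
proof
  have rt: "12 * (r * t j) \<le> t j" using r mult_right_mono[of "12 * r" 1 "t j"] t_pos[of j] by (simp add: algebra_simps)
  {
    assume "(x, y) \<in> S\<^sup>*"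
    from S[OF this] rt t_pos[of j] rt_pos[of j] show ?thesis by linarith
  next
    assume "\<exists>V\<in>W j. \<exists>u\<in>B j V. \<exists>u'\<in>B j V. (x, u) \<in> S\<^sup>* \<and> (u', y) \<in> S\<^sup>*"
    then obtain V u u' v v' where V: "V \<in> W j" "v \<in> V" "v' \<in> V" "dist v u \<le> 4 * r * t j"
      "dist v' u' \<le> 4 * r * t j" "(x, u) \<in> S\<^sup>*" "(u', y) \<in> S\<^sup>*"
      by (auto simp: B_def)
    have "dist x y \<le> dist x u + dist v u + dist v v' + dist v' u' + dist u' y"
      using dist_triangle[of x y u] dist_triangle[of u y u'] dist_triangle[of u u' v]
        dist_triangle[of v u' v'] by (simp add: dist_commute)
    also have "\<dots> \<le> 12 * (r * t j) + t j"
      using V(4,5) W_diam[OF V(1-3)] S[OF V(6)] S[OF V(7)] by simp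
    finally show ?thesis using rt by linarith
  }
qed

text \<open>Each chain uses only finitely many levels, so the bound on the diameter can be proved
  by downward induction from the finest level that occurs.\<close>

lemma F_capped_dist: "(x, y) \<in> (\<Union>i\<in>{j..<j + N}. Q i)\<^sup>* \<Longrightarrow> dist x y \<le> 2 * t j"
proof (induction N arbitrary: j x y)
  case 0
  then show ?case using t_pos[of j] by simp
next
  case (Suc N)
  have "{j..<j + Suc N} = insert j {Suc j..<Suc j + N}" by auto
  then have "(x, y) \<in> (Q j \<union> (\<Union>i\<in>{Suc j..<Suc j + N}. Q i))\<^sup>*" using Suc.prems by simp
  moreover have "dist x y \<le> 2 * r * t j" if "(x, y) \<in> (\<Union>i\<in>{Suc j..<Suc j + N}. Q i)\<^sup>*" for x y
    using Suc.IH[OF that] by (simp add: algebra_simps)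
  ultimately show ?case using Q_union_dist by blast
qed

lemma F_dist:
  assumes "(x, y) \<in> F j"
  shows "dist x y \<le> 2 * t j"
proof -
  have "\<exists>N. (x, y) \<in> (\<Union>i\<in>{j..<j + N}. Q i)\<^sup>*"
    using assms unfolding F_def
  proof (induction rule: rtrancl_induct)
    case (step y z)
    then obtain N i where N: "(x, y) \<in> (\<Union>i\<in>{j..<j + N}. Q i)\<^sup>*" "j \<le> i" "(y, z) \<in> Q i" by auto
    have "(x, y) \<in> (\<Union>i\<in>{j..<j + max N (Suc i)}. Q i)\<^sup>*"
      by (rule subsetD[OF rtrancl_mono N(1)]) (rule UN_mono, auto)
    moreover have "(y, z) \<in> (\<Union>i\<in>{j..<j + max N (Suc i)}. Q i)" using N by auto
    ultimately show ?case by (meson rtrancl.rtrancl_into_rtrancl)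
  qed auto
  then show ?thesis using F_capped_dist by blast
qed

lemma F_refl: "(x, x) \<in> F j"
  by (simp add: F_def)

lemma F_trans: "(x, y) \<in> F j \<Longrightarrow> (y, z) \<in> F j \<Longrightarrow> (x, z) \<in> F j"
  unfolding F_def by (rule rtrancl_trans)

lemma F_sym: "(x, y) \<in> F j \<Longrightarrow> (y, x) \<in> F j"
proof -
  have "sym (\<Union>i\<in>{j..}. Q i)" by (auto simp: sym_def Q_def)
  then show "(x, y) \<in> F j \<Longrightarrow> (y, x) \<in> F j" unfolding F_def by (meson sym_rtrancl symD)
qed

lemma F_antimono: "i \<le> j \<Longrightarrow> (x, y) \<in> F j \<Longrightarrow> (x, y) \<in> F i"
  unfolding F_def using rtrancl_mono[of "\<Union>(Q ` {j..})" "\<Union>(Q ` {i..})"] by (force intro: UN_mono)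

lemma B_F: "V \<in> W j \<Longrightarrow> x \<in> B j V \<Longrightarrow> y \<in> B j V \<Longrightarrow> (x, y) \<in> F j"
  unfolding F_def Q_def by (rule r_into_rtrancl) auto

lemma subset_B: "x \<in> V \<Longrightarrow> x \<in> B j V"
  using rt_pos[of j] by (auto simp: B_def intro!: bexI[of _ x])

text \<open>At level \<open>j\<close> two points count as identified when they are joined at finer levels or hang, through
  finer levels, on the same set of level \<open>j\<close>.  The thickening is not used here: it is the gap between
  \<open>V\<close> and \<open>B j V\<close> that makes close points agree at all but one level.\<close>

definition near :: "nat \<Rightarrow> 'a set \<Rightarrow> 'a \<Rightarrow> bool" where
  "near j V z \<longleftrightarrow> (\<exists>u\<in>V. (z, u) \<in> F (Suc j))"

definition E :: "nat \<Rightarrow> 'a \<Rightarrow> 'a \<Rightarrow> bool" where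
  "E j z z' \<longleftrightarrow> (z, z') \<in> F (Suc j) \<or> (\<exists>V\<in>W j. near j V z \<and> near j V z')"

definition L :: "'a \<Rightarrow> nat set" where
  "L z = {j. \<exists>V\<in>W j. near j V z}"

text \<open>As \<open>E\<close> is monotone in the level, this counts the levels of
  \<open>L z\<close> before the two points separate. For \<open>z = z'\<close> the set may be
  infinite with \<open>card\<close> 0, but \<open>meet\<close> treats equal rays apart.\<close>

definition g :: "'a \<Rightarrow> 'a \<Rightarrow> nat" where
  "g z z' = card {j \<in> L z. E j z z'}"

text \<open>The height that the ray of \<open>z\<close> has reached after the first \<open>k\<close>
  levels.\<close>

definition h :: "'a \<Rightarrow> nat \<Rightarrow> nat" where
  "h z k = card (L z \<inter> {..<k})"

section \<open>Nested identifications and gluing heights\<close>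

lemma near_F: "(z, z') \<in> F (Suc j) \<Longrightarrow> near j V z \<Longrightarrow> near j V z'"
  unfolding near_def by (meson F_sym F_trans)

lemma near_unique:
  assumes "V \<in> W j" "V' \<in> W j" "near j V z" "near j V' z"
  shows "V = V'"
proof -
  obtain u u' where u: "u \<in> V" "u' \<in> V'" "(u, u') \<in> F (Suc j)"
    using assms unfolding near_def by (meson F_sym F_trans)
  show ?thesis
    by (rule B_unique[OF assms(1,2) subset_B[OF u(1)] subset_B[OF u(2)]])
      (use F_dist[OF u(3)] in \<open>simp add: algebra_simps\<close>)
qed

lemma E_sym: "E j z z' \<Longrightarrow> E j z' z"
  unfolding E_def by (meson F_sym)

text \<open>Finer chains can be absorbed into \<open>near\<close>; when both relations come from
  sets of level \<open>j\<close>, separation makes these sets equal.\<close>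

lemma E_trans:
  assumes "E j x y" "E j y z"
  shows "E j x z"
proof -
  consider "(x, y) \<in> F (Suc j)" "(y, z) \<in> F (Suc j)"
    | V where "(x, y) \<in> F (Suc j)" "V \<in> W j" "near j V y" "near j V z"
    | V where "(y, z) \<in> F (Suc j)" "V \<in> W j" "near j V x" "near j V y"
    | V V' where "V \<in> W j" "near j V x" "near j V y" "V' \<in> W j" "near j V' y" "near j V' z"
    using assms unfolding E_def by blast
  then show ?thesis
  proof cases
    case 1
    then show ?thesis unfolding E_def by (blast intro: F_trans)
  next
    case 2
    then show ?thesis unfolding E_def using near_F[OF F_sym] by blast
  next
    case 3
    then show ?thesis unfolding E_def using near_F by blast
  next
    case 4
    then show ?thesis unfolding E_def using near_unique by blast
  qed
qed

lemma near_B: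
  assumes "near j V z"
  shows "\<exists>v\<in>V. dist v z \<le> 2 * r * t j"
proof -
  obtain v where v: "v \<in> V" "(z, v) \<in> F (Suc j)" using assms by (auto simp: near_def)
  from F_dist[OF v(2)] have "dist v z \<le> 2 * r * t j" by (simp add: dist_commute algebra_simps)
  with v show ?thesis by blast
qed

text \<open>With \<open>F_E\<close> this interleaves the two families of relations, so that
  \<open>E\<close> inherits nestedness and the diameter bound from \<open>F\<close>.\<close>

lemma E_F:
  assumes "E j z z'"
  shows "(z, z') \<in> F j"
  using assms unfolding E_def
proof
  assume "\<exists>V\<in>W j. near j V z \<and> near j V z'"
  then obtain V u u' where V: "V \<in> W j" "u \<in> V" "u' \<in> V" "(z, u) \<in> F (Suc j)" "(z', u') \<in> F (Suc j)"
    by (auto simp: near_def)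
  then have "(u, u') \<in> F j" by (intro B_F subset_B)
  with V show ?thesis by (meson F_antimono F_sym F_trans le_SucI order_refl)
qed (auto intro: F_antimono[of j "Suc j"])

lemma F_E: "i < j \<Longrightarrow> (z, z') \<in> F j \<Longrightarrow> E i z z'"
  unfolding E_def by (meson F_antimono Suc_leI)

lemma E_down: "i \<le> j \<Longrightarrow> E j z z' \<Longrightarrow> E i z z'"
  using F_E[OF _ E_F, of i j z z'] by (cases "i = j") auto

lemma E_L: "E j z z' \<Longrightarrow> j \<in> L z \<longleftrightarrow> j \<in> L z'"
  using near_F[of z z' j] near_F[OF F_sym, of z z' j] unfolding E_def L_def by blast

lemma E_finite:
  assumes "z \<noteq> z'"
  shows "finite {j. E j z z'}"
proof -
  have "(\<lambda>j. 2 * t j) \<longlonglongrightarrow> 2 * (t0 * 0)"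
    using r by (intro tendsto_intros LIMSEQ_realpow_zero) auto
  then have "\<forall>\<^sub>F j in sequentially. 2 * t j < dist z z'"
    by (rule order_tendstoD(2)) (use assms in simp)
  then obtain N where N: "\<And>j. j \<ge> N \<Longrightarrow> 2 * t j < dist z z'"
    by (auto simp: eventually_sequentially)
  have "{j. E j z z'} \<subseteq> {..<N}"
  proof
    fix j assume "j \<in> {j. E j z z'}"
    then have "dist z z' \<le> 2 * t j" by (intro F_dist E_F) simp
    with N[of j] show "j \<in> {..<N}" by (cases "j < N") auto
  qed
  then show ?thesis using finite_subset by blast
qed

lemma g_sym: "g z z' = g z' z"
proof -
  have "{j \<in> L z. E j z z'} = {j \<in> L z'. E j z' z}" using E_sym E_L[of _ z z'] E_L[of _ z' z] by blast
  then show ?thesis by (simp add: g_def)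
qed

text \<open>The levels at which a pair is identified form an initial segment, so those of
  \<open>x\<close>, \<open>y\<close> and of \<open>y\<close>, \<open>z\<close> are comparable. By
  transitivity the smaller segment also serves \<open>x\<close>, \<open>z\<close>.\<close>

lemma g_ultra:
  assumes "x \<noteq> z"
  shows "min (g x y) (g y z) \<le> g x z"
proof -
  have fin: "finite {j \<in> L w. E j x z}" for w
    using E_finite[OF assms] by (rule finite_subset[rotated]) auto
  consider "\<And>j. E j x y \<Longrightarrow> E j y z" | "\<And>j. E j y z \<Longrightarrow> E j x y"
  proof (cases "\<forall>j. E j x y \<longrightarrow> E j y z")
    case False
    then obtain i where i: "E i x y" "\<not> E i y z" by blast
    have "E j x y" if "E j y z" for j
    proof -
      have "j \<le> i" using E_down[of i j y z] that i by (cases "j \<le> i") auto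
      then show ?thesis using E_down i by blast
    qed
    then show ?thesis using that by blast
  qed blast
  then show ?thesis
  proof cases
    case 1
    then have "g x y \<le> g x z"
      unfolding g_def by (intro card_mono fin) (use E_trans in blast)
    then show ?thesis by simp
  next
    case 2
    have "g z y \<le> g z x"
      unfolding g_def
    proof (rule card_mono)
      show "finite {j \<in> L z. E j z x}" by (rule finite_subset[OF _ fin[of z]]) (use E_sym in blast)
      show "{j \<in> L z. E j z y} \<subseteq> {j \<in> L z. E j z x}" using 2 E_trans E_sym by blast
    qed
    then show ?thesis by (simp add: g_sym[of z])
  qed
qed

sublocale ray_gluing "\<lambda>x y. real (g x y)"
proof
  fix x y z :: 'a assume "x \<noteq> z"
  from g_ultra[OF this] show "min (real (g x y)) (real (g y z)) \<le> real (g x z)"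
    by (simp flip: of_nat_min)
qed (simp_all add: g_sym)

section \<open>Tree distances in terms of levels\<close>

lemma h_mono: "p \<le> k \<Longrightarrow> h z p \<le> h z k"
  unfolding h_def by (rule card_mono) auto

lemma h_diff: "p \<le> k \<Longrightarrow> h z k = h z p + card (L z \<inter> {p..<k})"
proof -
  assume "p \<le> k"
  then have "L z \<inter> {..<k} = (L z \<inter> {..<p}) \<union> (L z \<inter> {p..<k})" by auto
  moreover have "(L z \<inter> {..<p}) \<inter> (L z \<inter> {p..<k}) = {}" by auto
  ultimately show ?thesis unfolding h_def by (simp add: card_Un_disjoint)
qed

lemma h_le: "p \<le> k \<Longrightarrow> h z k \<le> h z p + (k - p)"
  using h_diff[of p k z] card_mono[of "{p..<k}" "L z \<inter> {p..<k}"] by simp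

text \<open>If two close points are separated at a level \<open>j \<in> L z\<close>, both lie in the same \<open>B j V\<close>,
  so they are identified at all coarser levels; hence at most one level separates them.\<close>

lemma h_le_common:
  assumes close: "\<And>j. j < p \<Longrightarrow> dist z z' \<le> r * t j"
  shows "h z p \<le> card {j \<in> L z. E j z z' \<and> j < p} + 1"
proof -
  let ?S = "{j \<in> L z. \<not> E j z z' \<and> j < p}"
  have coarser: "E i z z'" if j: "j \<in> ?S" and "i < j" for i j
  proof -
    obtain V where V: "V \<in> W j" "near j V z" using j by (auto simp: L_def)
    obtain v where v: "v \<in> V" "dist v z \<le> 2 * r * t j" using near_B[OF V(2)] by blast
    have "dist v z' \<le> 4 * r * t j"
      using dist_triangle[of v z' z] v(2) close[of j] j rt_pos[of j] by simp
    moreover have "dist v z \<le> 4 * r * t j" using v(2) rt_pos[of j] by simp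
    ultimately have "(z, z') \<in> F j"
      using V(1) v(1) by (intro B_F) (auto simp: B_def)
    with \<open>i < j\<close> show ?thesis by (rule F_E)
  qed
  have "card ?S \<le> 1"
  proof -
    have "i = j" if "i \<in> ?S" "j \<in> ?S" for i j
      using coarser[OF that(1), of j] coarser[OF that(2), of i] that by (cases i j rule: linorder_cases) auto
    then show ?thesis using card_le_Suc0_iff_eq[of ?S] by auto
  qed
  moreover have "L z \<inter> {..<p} = {j \<in> L z. E j z z' \<and> j < p} \<union> ?S" by auto
  ultimately show ?thesis
    using card_Un_le[of "{j \<in> L z. E j z z' \<and> j < p}" ?S] unfolding h_def by simp
qed

text \<open>A level of \<open>L z\<close> at which the points are identified also lies in
  \<open>L z'\<close>, so only the exceptional level of \<open>h_le_common\<close> is lost.\<close>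

lemma h_le_h:
  assumes "\<And>j. j < p \<Longrightarrow> dist z z' \<le> r * t j"
  shows "h z p \<le> h z' p + 1"
proof -
  have "card {j \<in> L z. E j z z' \<and> j < p} \<le> h z' p"
    unfolding h_def by (rule card_mono) (use E_L in auto)
  with h_le_common[of p z z'] assms show ?thesis by simp
qed

lemma h_le_g:
  assumes "z \<noteq> z'" "\<And>j. j < p \<Longrightarrow> dist z z' \<le> r * t j"
  shows "h z p \<le> g z z' + 1"
proof -
  have "finite {j \<in> L z. E j z z'}"
    using E_finite[OF assms(1)] by (rule finite_subset[rotated]) auto
  then have "card {j \<in> L z. E j z z' \<and> j < p} \<le> g z z'"
    unfolding g_def by (rule card_mono) auto
  with h_le_common[of p z z'] assms(2) show ?thesis by simp
qed

lemma g_le_h: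
  assumes "2 * t q < dist z z'"
  shows "g z z' \<le> h z q"
  unfolding g_def h_def
proof (rule card_mono)
  show "finite (L z \<inter> {..<q})" by simp
  show "{j \<in> L z. E j z z'} \<subseteq> L z \<inter> {..<q}"
  proof safe
    fix j assume j: "E j z z'"
    show "j < q"
    proof (rule ccontr)
      assume "\<not> j < q"
      then have "E q z z'" using E_down[of q j] j by auto
      with F_dist[OF E_F, of q z z'] assms show False by simp
    qed
  qed
qed

text \<open>Before level \<open>p\<close> the rays agree up to one level, which costs at most 2;
  after it each ray grows by at most one per level.\<close>

lemma ray_dist_upper:
  assumes "p \<le> k" "p \<le> k'" "\<And>j. j < p \<Longrightarrow> dist z z' \<le> r * t j"
  shows "ray_dist (z, real (h z k)) (z', real (h z' k')) \<le> real k + real k' - 2 * real p + 2"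
proof -
  have "h z p \<le> h z' p + 1" "h z' p \<le> h z p + 1"
    "z \<noteq> z' \<Longrightarrow> h z p \<le> g z z' + 1" "z \<noteq> z' \<Longrightarrow> h z' p \<le> g z z' + 1"
    using assms(3) h_le_h[of p z z'] h_le_h[of p z' z] h_le_g[of z z' p] h_le_g[of z' z p] g_sym[of z z']
    by (auto simp: dist_commute)
  moreover have "h z k \<le> h z p + (k - p)" "h z' k' \<le> h z' p + (k' - p)" "h z p \<le> h z k" "h z' p \<le> h z' k'"
    using assms(1,2) h_le h_mono by auto
  ultimately show ?thesis
    using assms(1,2) unfolding ray_dist_def meet_def by (auto simp: min_def of_nat_diff)
qed

text \<open>Only the part of the path on the ray of \<open>z\<close> is kept. If
  \<open>m < k'\<close>, the rays have separated by level \<open>m + 2\<close>, at most two counted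
  levels past \<open>p\<close>; otherwise the other point has height at most
  \<open>h z p + 1\<close>.\<close>

lemma ray_dist_lower:
  assumes p: "p = min k' m" and close: "\<And>j. j < p \<Longrightarrow> dist z z' \<le> r * t j"
    and far: "m < k' \<Longrightarrow> 2 * t (m + 2) < dist z z'"
  shows "real (h z k) - real (h z p) - 2 \<le> ray_dist (z, real (h z k)) (z', real (h z' k'))"
proof -
  have "meet (z, real (h z k)) (z', real (h z' k')) \<le> real (h z p) + 2"
  proof (cases "m < k'")
    case True
    have "0 < dist z z'" using far[OF True] t_pos[of "m + 2"] by linarith
    then have "z \<noteq> z'" by auto
    moreover have "g z z' \<le> h z m + 2" using g_le_h[OF far[OF True]] h_le[of m "m + 2" z] by simp
    ultimately show ?thesis using True p by (auto simp: meet_def min_def)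
  next
    case False
    then have "h z' k' \<le> h z p + 1" using h_le_h[of p z' z] close p by (auto simp: dist_commute)
    then show ?thesis by (auto simp: meet_def min_def)
  qed
  moreover have "meet (z, real (h z k)) (z', real (h z' k')) \<le> real (h z' k')"
    by (auto simp: meet_def)
  ultimately show ?thesis unfolding ray_dist_def by simp
qed

lemma in_L: "V \<in> W j \<Longrightarrow> z \<in> V \<Longrightarrow> j \<in> L z"
  by (auto simp: L_def near_def intro: F_refl)

end

section \<open>Distances in the hyperbolic cone\<close>

text \<open>A weak Jordan inequality: the cubic Taylor term is at most two thirds of
  \<open>x\<close> because \<open>x \<le> 2\<close>.\<close>

lemma sin_ge_third:
  fixes x :: real
  assumes "0 \<le> x" "x \<le> pi / 2"
  shows "x / 3 \<le> sin x"
proof -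
  have "\<bar>sin x - (\<Sum>m<3. sin_coeff m * x ^ m)\<bar> \<le> inverse (fact 3) * \<bar>x\<bar> ^ 3"
    by (rule Maclaurin_sin_bound)
  moreover have "(\<Sum>m<3. sin_coeff m * x ^ m) = x" "inverse (fact 3) * \<bar>x\<bar> ^ 3 = x ^ 3 / 6"
    using assms by (simp_all add: sin_coeff_def eval_nat_numeral)
  ultimately have "x - x ^ 3 / 6 \<le> sin x" by linarith
  moreover have "x ^ 3 \<le> x * 4"
  proof -
    have "x \<le> 2" using assms pi_less_4 by simp
    then have "x ^ 2 \<le> 2 ^ 2" using assms by (intro power_mono) auto
    then have "x * x ^ 2 \<le> x * 4" using assms by (intro mult_left_mono) auto
    then show ?thesis by (simp add: eval_nat_numeral)
  qed
  ultimately show ?thesis by simp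
qed

lemma one_minus_cos: "1 - cos x = 2 * (sin (x / 2))\<^sup>2" for x :: real
  using cos_double_sin[of "x / 2"] by simp

lemma one_minus_cos_le: "1 - cos x \<le> x\<^sup>2 / 2" for x :: real
proof -
  have "(sin (x / 2))\<^sup>2 \<le> (x / 2)\<^sup>2"
    using abs_sin_x_le_abs_x[of "x / 2"] unfolding abs_le_square_iff .
  then show ?thesis by (simp add: one_minus_cos power_divide)
qed

lemma one_minus_cos_ge:
  fixes x :: real
  assumes "0 \<le> x" "x \<le> pi"
  shows "x\<^sup>2 / 18 \<le> 1 - cos x"
proof -
  have "(x / 6)\<^sup>2 \<le> (sin (x / 2))\<^sup>2"
    using sin_ge_third[of "x / 2"] assms by (intro power_mono) auto
  then show ?thesis by (simp add: one_minus_cos power_divide)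
qed

text \<open>The law of cosines split into a radial and an angular term, both nonnegative for radii
  at least 0. The sum is at least 1, so \<open>arcosh\<close> can be inverted.\<close>

lemma cosh_cone_dist:
  assumes "0 \<le> s" "0 \<le> s'"
  shows "cosh (cone_dist Z (z, s) (z', s')) =
      cosh (s - s') + sinh s * sinh s' * (1 - cos (cone_angle Z z z'))"
    and "0 \<le> cone_dist Z (z, s) (z', s')"
proof -
  let ?X = "cosh (s - s') + sinh s * sinh s' * (1 - cos (cone_angle Z z z'))"
  have eq: "cone_dist Z (z, s) (z', s') = arcosh ?X"
    by (simp add: cone_dist_def cosh_diff algebra_simps)
  have "0 \<le> sinh s * sinh s' * (1 - cos (cone_angle Z z z'))"
    using assms by (intro mult_nonneg_nonneg) auto
  then have "1 \<le> ?X" using cosh_real_ge_1[of "s - s'"] by linarith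
  then show "cosh (cone_dist Z (z, s) (z', s')) = ?X" "0 \<le> cone_dist Z (z, s) (z', s')"
    by (simp_all add: eq)
qed

lemma cone_dist_same:
  assumes "0 \<le> s" "0 \<le> s'"
  shows "cone_dist Z (z, s) (z, s') = \<bar>s - s'\<bar>"
proof -
  have "cosh (cone_dist Z (z, s) (z, s')) = cosh \<bar>s - s'\<bar>"
    using cosh_cone_dist(1)[OF assms, of Z z z] by (simp add: cone_angle_def)
  then show ?thesis
    using cosh_cone_dist(2)[OF assms, of Z z z] by (metis abs_ge_zero arcosh_cosh_real)
qed

lemma cosh_le_exp: "cosh x \<le> exp \<bar>x\<bar>" for x :: real
  by (cases "0 \<le> x") (auto simp: cosh_def)

lemma exp_le_cosh: "exp \<bar>x\<bar> \<le> 2 * cosh x" for x :: real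
  by (cases "0 \<le> x") (auto simp: cosh_def)

lemma sinh_ge_exp:
  fixes x :: real
  assumes "1 \<le> x"
  shows "exp x / 4 \<le> sinh x"
proof -
  have "2 \<le> exp x" using exp_ge_add_one_self[of x] assms by linarith
  then have "2 * 2 \<le> exp x * exp x" by (intro mult_mono) auto
  then have "2 * exp (- x) \<le> exp x" using exp_gt_zero[of x]
    by (simp add: exp_minus field_simps)
  then show ?thesis by (simp add: sinh_def)
qed

text \<open>Up to bounded errors, \<open>l k\<close> and \<open>l k'\<close> are the radii of the two points and \<open>l m\<close> is the radius
  at which their rays start to diverge.\<close>

lemma hyperbolic_side_estimate:
  fixes D s s' \<theta> l c1 c2 :: real and k k' m p :: nat
  assumes l: "1 \<le> l" and s: "l * k \<le> s" "s \<le> l * (k + 1)" and s': "l * k' \<le> s'" "s' \<le> l * (k' + 1)"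
    and \<theta>: "0 \<le> \<theta>" "\<theta> \<le> pi" "c1 * exp (- l * m) \<le> \<theta>" "\<theta> \<le> c2 * exp (- l * m)" and c1: "0 < c1"
    and D: "0 \<le> D" "cosh D = cosh (s - s') + sinh s * sinh s' * (1 - cos \<theta>)"
    and p: "p = min (min k k') m"
  shows "\<bar>D - l * (real k + real k' - 2 * real p)\<bar> \<le> 2 * l + ln (2 * (1 + c2\<^sup>2)) + ln 2 + \<bar>ln (c1\<^sup>2 / 288)\<bar>"
proof -
  define N where "N = real k + real k' - 2 * real p"
  have ss: "0 \<le> s" "0 \<le> s'" using s s' l by (meson of_nat_0_le_iff mult_nonneg_nonneg order_trans zero_le_one)+
  have lp: "l * real p \<le> l * real m" "l * real p \<le> l * real k" "l * real p \<le> l * real k'"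
    using l p by (auto intro!: mult_left_mono)
  have kk: "l * N = l * k + l * k' - 2 * (l * p)" by (simp add: N_def algebra_simps)
  have s_le: "s \<le> l * k + l" "s' \<le> l * k' + l" using s s' by (simp_all add: algebra_simps)
  have "exp D \<le> 2 * cosh D" using exp_le_cosh[of D] D(1) by simp
  \<comment> \<open>The radial and the angular term are bounded separately; \<open>2 * l\<close>
    accounts for rounding both radii down to multiples of \<open>l\<close>.\<close>
  also have "cosh D \<le> exp (l * N + 2 * l) + c2\<^sup>2 * exp (l * N + 2 * l)"
  proof -
    have "\<bar>s - s'\<bar> \<le> l * N + 2 * l"
      using s s' s_le lp l unfolding kk by linarith
    then have "cosh (s - s') \<le> exp (l * N + 2 * l)"
      by (meson cosh_le_exp exp_le_cancel_iff order_trans)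
    moreover have "sinh s * sinh s' * (1 - cos \<theta>) \<le> exp s * exp s' * (c2 * exp (- l * m))\<^sup>2"
    proof (intro mult_mono)
      have "\<theta>\<^sup>2 \<le> (c2 * exp (- l * m))\<^sup>2" using \<theta> by (intro power_mono) auto
      then show "1 - cos \<theta> \<le> (c2 * exp (- l * m))\<^sup>2"
        using one_minus_cos_le[of \<theta>] zero_le_power2[of \<theta>] by linarith
      show "sinh s \<le> exp s" "sinh s' \<le> exp s'"
        using exp_gt_zero[of s] exp_gt_zero[of "-s"] exp_gt_zero[of s'] exp_gt_zero[of "-s'"]
        unfolding sinh_def by (simp_all add: field_simps)
    qed (use ss in auto)
    moreover have "exp s * exp s' * (c2 * exp (- l * m))\<^sup>2 = c2\<^sup>2 * exp (s + s' - 2 * (l * m))"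
      by (simp add: power_mult_distrib exp_add exp_diff exp_minus field_simps flip: exp_double)
    moreover have "c2\<^sup>2 * exp (s + s' - 2 * (l * m)) \<le> c2\<^sup>2 * exp (l * N + 2 * l)"
      using s_le lp unfolding kk by (intro mult_left_mono) auto
    ultimately show ?thesis using D(2) by linarith
  qed
  finally have "exp D \<le> 2 * (1 + c2\<^sup>2) * exp (l * N + 2 * l)" by (simp add: algebra_simps)
  also have "\<dots> = exp (ln (2 * (1 + c2\<^sup>2)) + (l * N + 2 * l))"
    by (subst exp_add, subst exp_ln) (auto simp: add_pos_nonneg)
  finally have upper: "D \<le> l * N + (2 * l + ln (2 * (1 + c2\<^sup>2)))" by simp

  have cD: "cosh D \<le> exp D" using cosh_le_exp[of D] D(1) by simp
  have prod: "0 \<le> sinh s * sinh s' * (1 - cos \<theta>)" using ss by (intro mult_nonneg_nonneg) auto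
  have lower: "l * N - (l + ln 2 + \<bar>ln (c1\<^sup>2 / 288)\<bar>) \<le> D"
  \<comment> \<open>If the rays diverge before either point is reached, the angular term gives the
    bound; otherwise \<open>p\<close> is \<open>k\<close> or \<open>k'\<close> and the radial term
    suffices.\<close>
  proof (cases "p = m \<and> m < k \<and> m < k'")
    case True
    then have "l * 1 \<le> l * k" "l * 1 \<le> l * k'" using l by (intro mult_left_mono; simp)+
    then have "1 \<le> s" "1 \<le> s'" using l s s' by linarith+
    \<comment> \<open>Both \<open>sinh\<close> factors lose 4 and \<open>1 - cos \<theta>\<close>
      loses 18, whence 288.\<close>
    then have "(exp s / 4) * (exp s' / 4) * ((c1 * exp (- l * m))\<^sup>2 / 18) \<le> sinh s * sinh s' * (1 - cos \<theta>)"
    proof (intro mult_mono sinh_ge_exp)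
      have "(c1 * exp (- l * m))\<^sup>2 \<le> \<theta>\<^sup>2" using \<theta> c1 by (intro power_mono) auto
      then show "(c1 * exp (- l * m))\<^sup>2 / 18 \<le> 1 - cos \<theta>"
        using one_minus_cos_ge[OF \<theta>(1,2)] by linarith
    qed (use ss in auto)
    moreover have "(exp s / 4) * (exp s' / 4) * ((c1 * exp (- l * m))\<^sup>2 / 18) = c1\<^sup>2 / 288 * exp (s + s' - 2 * (l * m))"
      by (simp add: power_mult_distrib exp_add exp_diff exp_minus field_simps flip: exp_double)
    moreover have "c1\<^sup>2 / 288 * exp (l * N) \<le> c1\<^sup>2 / 288 * exp (s + s' - 2 * (l * m))"
      using s s' True unfolding kk by (intro mult_left_mono) auto
    ultimately have "c1\<^sup>2 / 288 * exp (l * N) \<le> exp D"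
      using cD D(2) cosh_real_nonneg[of "s - s'"] by linarith
    moreover have "c1\<^sup>2 / 288 * exp (l * N) = exp (ln (c1\<^sup>2 / 288) + l * N)"
      using c1 by (simp add: exp_add)
    ultimately have "ln (c1\<^sup>2 / 288) + l * N \<le> D" by simp
    moreover have "0 \<le> ln (2::real)" by simp
    ultimately show ?thesis using l by linarith
  next
    case False
    then have "p = k \<or> p = k'" using p by auto
    then have "l * N - l \<le> \<bar>s - s'\<bar>"
      using s s' s_le unfolding kk by auto
    then have "exp (l * N - l) \<le> exp \<bar>s - s'\<bar>" by simp
    also have "\<dots> \<le> 2 * exp D" using exp_le_cosh[of "s - s'"] cD D(2) prod by linarith
    also have "\<dots> = exp (ln 2 + D)" by (simp add: exp_add)
    finally show ?thesis by simp
  qed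
  have "0 \<le> ln (2::real)" "0 \<le> ln (2 * (1 + c2\<^sup>2))" by (auto intro!: ln_ge_zero simp: add_increasing2)
  with upper lower l show ?thesis unfolding N_def[symmetric] by linarith
qed

section \<open>Embedding the cone\<close>

text \<open>The facts about one colour, stated outside the locale so that the trees of all colours
  can be obtained by choice. \<open>\<phi> z k\<close> is the point on the ray of \<open>z\<close>
  at level \<open>k\<close>.\<close>

definition coarse_tree ::
    "(nat \<Rightarrow> 'a::metric_space set set) \<Rightarrow> real \<Rightarrow> real \<Rightarrow> 'b set \<Rightarrow> ('b \<Rightarrow> 'b \<Rightarrow> real) \<Rightarrow>
      ('a \<Rightarrow> nat \<Rightarrow> 'b) \<Rightarrow> ('a \<Rightarrow> nat set) \<Rightarrow> bool" where
  "coarse_tree W r t0 T d \<phi> L \<longleftrightarrow> metric_tree T d \<and> (\<forall>z k. \<phi> z k \<in> T) \<and>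
    (\<forall>j V z. V \<in> W j \<and> z \<in> V \<longrightarrow> j \<in> L z) \<and>
    (\<forall>z z' k k' p. p \<le> k \<and> p \<le> k' \<and> (\<forall>j<p. dist z z' \<le> r * (t0 * r ^ j)) \<longrightarrow>
       d (\<phi> z k) (\<phi> z' k') \<le> real k + real k' - 2 * real p + 2) \<and>
    (\<forall>z z' k k' m. min k' m \<le> k \<and> (\<forall>j<min k' m. dist z z' \<le> r * (t0 * r ^ j)) \<and>
       (m < k' \<longrightarrow> 2 * (t0 * r ^ (m + 2)) < dist z z') \<longrightarrow>
       real (card (L z \<inter> {min k' m..<k})) - 2 \<le> d (\<phi> z k) (\<phi> z' k'))"

lemma coarse_treeD:
  assumes "coarse_tree W r t0 T d \<phi> L"
  shows "metric_tree T d" and "\<phi> z k \<in> T" and "V \<in> W j \<Longrightarrow> z \<in> V \<Longrightarrow> j \<in> L z"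
    and "p \<le> k \<Longrightarrow> p \<le> k' \<Longrightarrow> \<forall>j<p. dist z z' \<le> r * (t0 * r ^ j) \<Longrightarrow>
       d (\<phi> z k) (\<phi> z' k') \<le> real k + real k' - 2 * real p + 2"
    and "min k' m \<le> k \<Longrightarrow> \<forall>j<min k' m. dist z z' \<le> r * (t0 * r ^ j) \<Longrightarrow>
       m < k' \<longrightarrow> 2 * (t0 * r ^ (m + 2)) < dist z z' \<Longrightarrow>
       real (card (L z \<inter> {min k' m..<k})) - 2 \<le> d (\<phi> z k) (\<phi> z' k')"
proof -
  note * = assms[unfolded coarse_tree_def]
  note tail = *[THEN conjunct2, THEN conjunct2]
  show "metric_tree T d" "\<phi> z k \<in> T" using * by auto
  show "V \<in> W j \<Longrightarrow> z \<in> V \<Longrightarrow> j \<in> L z" using tail[THEN conjunct1] by blast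
  show "p \<le> k \<Longrightarrow> p \<le> k' \<Longrightarrow> \<forall>j<p. dist z z' \<le> r * (t0 * r ^ j) \<Longrightarrow>
       d (\<phi> z k) (\<phi> z' k') \<le> real k + real k' - 2 * real p + 2"
    using tail[THEN conjunct2, THEN conjunct1] by blast
  show "min k' m \<le> k \<Longrightarrow> \<forall>j<min k' m. dist z z' \<le> r * (t0 * r ^ j) \<Longrightarrow>
       m < k' \<longrightarrow> 2 * (t0 * r ^ (m + 2)) < dist z z' \<Longrightarrow>
       real (card (L z \<inter> {min k' m..<k})) - 2 \<le> d (\<phi> z k) (\<phi> z' k')"
    using tail[THEN conjunct2, THEN conjunct2] by blast
qed

lemma (in hierarchy) coarse_tree_exists:
  "\<exists>T (d :: 'a \<times> real \<Rightarrow> 'a \<times> real \<Rightarrow> real) \<phi> L. coarse_tree W r t0 T d \<phi> L"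
proof -
  define \<phi> where "\<phi> z k = rep (z, real (h z k))" for z k
  have rays: "(z, real (h z k)) \<in> rays" for z k by (simp add: rays_def)
  have "coarse_tree W r t0 (rep ` rays) ray_dist \<phi> L"
    unfolding coarse_tree_def
  proof (intro conjI allI impI; (elim conjE)?)
    show "metric_tree (rep ` rays) ray_dist" by (rule metric_tree_rays)
    show "\<phi> z k \<in> rep ` rays" for z k using rays by (simp add: \<phi>_def)
    show "j \<in> L z" if "V \<in> W j" "z \<in> V" for j V z using in_L that .
    fix z z' k k'
    have \<phi>: "ray_dist (\<phi> z k) (\<phi> z' k') = ray_dist (z, real (h z k)) (z', real (h z' k'))"
      by (simp add: \<phi>_def ray_dist_rep rays)
    show "ray_dist (\<phi> z k) (\<phi> z' k') \<le> real k + real k' - 2 * real p + 2"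
      if "p \<le> k" "p \<le> k'" "\<forall>j<p. dist z z' \<le> r * t j" for p
      unfolding \<phi> using ray_dist_upper that by blast
    show "real (card (L z \<inter> {min k' m..<k})) - 2 \<le> ray_dist (\<phi> z k) (\<phi> z' k')"
      if "min k' m \<le> k" "\<forall>j<min k' m. dist z z' \<le> r * t j" "m < k' \<longrightarrow> 2 * t (m + 2) < dist z z'" for m
    proof -
      have "real (h z k) - real (h z (min k' m)) - 2 \<le> ray_dist (\<phi> z k) (\<phi> z' k')"
        unfolding \<phi> using ray_dist_lower[OF refl, of k' m z z' k] that by blast
      then show ?thesis using h_diff[OF that(1), of z] by simp
    qed
  qed
  then show ?thesis by blast
qed

text \<open>Each covering set is shrunk to its points of depth more than
  \<open>\<delta> / 2 * \<tau>\<close>. A point of another shrunken set of the same colour lies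
  outside the original set, hence is that far away. The Lebesgue number keeps \<open>Z\<close>
  covered; as its supremum need not be attained, half of \<open>\<delta>\<close> is given
  up.\<close>

lemma cdim_separated_families:
  fixes Z :: "'a::metric_space set"
  assumes "bounded Z" and "cdim Z = enat n"
  obtains \<delta> \<tau>0 where "0 < \<delta>" "0 < \<tau>0"
    "\<And>\<tau>. 0 < \<tau> \<Longrightarrow> \<tau> \<le> \<tau>0 \<Longrightarrow> \<exists>\<W> :: nat \<Rightarrow> 'a set set.
      (\<forall>a<Suc n. \<forall>V\<in>\<W> a. \<forall>x\<in>V. \<forall>y\<in>V. dist x y \<le> \<tau>) \<and>
      (\<forall>a<Suc n. \<forall>V\<in>\<W> a. \<forall>V'\<in>\<W> a. V \<noteq> V' \<longrightarrow> (\<forall>x\<in>V. \<forall>y\<in>V'. \<delta> * \<tau> < dist x y)) \<and>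
      (\<forall>z\<in>Z. \<exists>a<Suc n. \<exists>V\<in>\<W> a. z \<in> V)"
proof -
  have ex: "\<exists>m. cdim_witness Z m" and "n = (LEAST m. cdim_witness Z m)"
    using assms(2) by (auto simp: cdim_def split: if_splits)
  then have "cdim_witness Z n" using LeastI_ex[OF ex] by simp
  then obtain \<delta> \<tau>0 where \<delta>: "0 < \<delta>" "0 < \<tau>0"
    and cov: "\<And>\<tau>. 0 < \<tau> \<Longrightarrow> \<tau> \<le> \<tau>0 \<Longrightarrow> \<exists>\<U>. open_covering Z \<U> \<and> colored (Suc n) \<U> \<and> mesh \<U> \<le> ereal \<tau> \<and>
            lebesgue_number Z \<U> \<ge> ereal (\<delta> * \<tau>)"
    unfolding cdim_witness_def by blast
  show thesis
  proof (rule that[of "\<delta> / 2" \<tau>0])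
    fix \<tau> assume \<tau>: "0 < \<tau>" "\<tau> \<le> \<tau>0"
    obtain \<U> where U: "open_covering Z \<U>" "colored (Suc n) \<U>" "mesh \<U> \<le> ereal \<tau>"
      "lebesgue_number Z \<U> \<ge> ereal (\<delta> * \<tau>)" using cov[OF \<tau>] by blast
    obtain \<F> where F: "\<U> = (\<Union>i<Suc n. \<F> i)" "\<And>i. i < Suc n \<Longrightarrow> pairwise disjnt (\<F> i)"
      using U(2) unfolding colored_def by blast
    define sh where "sh U = {z\<in>Z. ereal (\<delta> / 2 * \<tau>) < setdist_e z (Z - U)}" for U
    have far: "\<delta> / 2 * \<tau> < dist z y" if "z \<in> sh U" "y \<in> Z" "y \<notin> U" for z y U
    proof -
      have "ereal (\<delta> / 2 * \<tau>) < setdist_e z (Z - U)"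
        using that(1) unfolding sh_def by blast
      also have "setdist_e z (Z - U) \<le> ereal (dist z y)"
        unfolding setdist_e_def using that by (intro INF_lower) auto
      finally show ?thesis by (simp only: ereal_less(1) less_ereal.simps)
    qed
    have sh_sub: "sh U \<subseteq> U \<inter> Z" for U
    proof
      fix z assume z: "z \<in> sh U"
      then have "z \<in> Z" by (simp add: sh_def)
      moreover have "z \<in> U"
      proof (rule ccontr)
        assume "z \<notin> U"
        from far[OF z \<open>z \<in> Z\<close> this] \<delta> \<tau> mult_pos_pos[OF \<delta>(1) \<tau>(1)] show False by simp
      qed
      ultimately show "z \<in> U \<inter> Z" by simp
    qed
    let ?W = "\<lambda>a. sh ` \<F> a"
    show "\<exists>\<W> :: nat \<Rightarrow> 'a set set.
      (\<forall>a<Suc n. \<forall>V\<in>\<W> a. \<forall>x\<in>V. \<forall>y\<in>V. dist x y \<le> \<tau>) \<and>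
      (\<forall>a<Suc n. \<forall>V\<in>\<W> a. \<forall>V'\<in>\<W> a. V \<noteq> V' \<longrightarrow> (\<forall>x\<in>V. \<forall>y\<in>V'. \<delta> / 2 * \<tau> < dist x y)) \<and>
      (\<forall>z\<in>Z. \<exists>a<Suc n. \<exists>V\<in>\<W> a. z \<in> V)"
    proof (intro exI[of _ ?W] conjI allI impI ballI)
      fix a V x y assume a: "a < Suc n" and V: "V \<in> sh ` \<F> a" and "x \<in> V" "y \<in> V"
      then obtain U where U': "U \<in> \<F> a" "x \<in> U" "y \<in> U" using sh_sub by blast
      then have UU: "U \<in> \<U>" using F(1) a by blast
      then have "U \<subseteq> Z" using U(1) unfolding open_covering_def by (meson openin_imp_subset)
      then have "dist x y \<le> diameter U"
        using assms(1) U' by (intro diameter_bounded_bound) (auto intro: bounded_subset)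
      moreover have "ereal (diameter U) \<le> ereal \<tau>"
        using SUP_upper[OF UU, of "\<lambda>U. ereal (diameter U)"] U(3) unfolding mesh_def by (rule order_trans)
      ultimately show "dist x y \<le> \<tau>" by simp
    next
      fix a V V' x y assume a: "a < Suc n" and V: "V \<in> sh ` \<F> a" "V' \<in> sh ` \<F> a" "V \<noteq> V'"
        and xy: "x \<in> V" "y \<in> V'"
      obtain U U' where UU: "U \<in> \<F> a" "U' \<in> \<F> a" "V = sh U" "V' = sh U'" using V by blast
      then have "disjnt U U'" using F(2)[OF a] V(3) by (auto simp: pairwise_def)
      then have "y \<in> Z" "y \<notin> U" using sh_sub[of U'] xy UU by (auto simp: disjnt_def)
      then show "\<delta> / 2 * \<tau> < dist x y" using far xy UU by blast
    next
      fix z assume z: "z \<in> Z"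
      have "ereal (\<delta> / 2 * \<tau>) < ereal (\<delta> * \<tau>)" using \<delta> \<tau> by simp
      also have "\<dots> \<le> lebesgue_number Z \<U>" by (rule U(4))
      also have "\<dots> \<le> min (SUP U\<in>\<U>. setdist_e z (Z - U)) (mesh \<U>)"
        unfolding lebesgue_number_def using z by (rule INF_lower)
      also have "\<dots> \<le> (SUP U\<in>\<U>. setdist_e z (Z - U))" by simp
      finally obtain U where "U \<in> \<U>" "ereal (\<delta> / 2 * \<tau>) < setdist_e z (Z - U)"
        by (auto simp: less_SUP_iff)
      then have "U \<in> \<U>" "z \<in> sh U" using z by (auto simp: sh_def)
      then show "\<exists>a<Suc n. \<exists>V\<in>sh ` \<F> a. z \<in> V" using F(1) by auto
    qed
  qed (use \<delta> in auto)
qed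

lemma cone_dist_commute: "cone_dist Z x y = cone_dist Z y x"
  by (simp add: cone_dist_def cone_angle_def dist_commute mult.commute)

lemma sum_card_cover:
  assumes "finite A" "\<And>j. j < k \<Longrightarrow> \<exists>a\<in>A. j \<in> L a"
  shows "k - p \<le> (\<Sum>a\<in>A. card (L a \<inter> {p..<k}))"
proof -
  have "{p..<k} \<subseteq> (\<Union>a\<in>A. L a \<inter> {p..<k})" using assms(2) by auto
  then have "card {p..<k} \<le> card (\<Union>a\<in>A. L a \<inter> {p..<k})"
    using assms(1) by (intro card_mono) auto
  also have "\<dots> \<le> (\<Sum>a\<in>A. card (L a \<inter> {p..<k}))"
    by (rule card_UN_le[OF assms(1)])
  finally show ?thesis by simp
qed

theorem theorem3p1:
  fixes Z :: "'a::metric_space set" and n :: nat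
  assumes "bounded Z"
    and "cdim Z = enat n"
  shows "\<exists>(A::nat set) (T::nat \<Rightarrow> ('a \<times> real) set) (d::nat \<Rightarrow> ('a \<times> real) \<Rightarrow> ('a \<times> real) \<Rightarrow> real)
           (f::'a \<times> real \<Rightarrow> nat \<Rightarrow> 'a \<times> real).
           finite A \<and> card A = n + 1 \<and>
           (\<forall>a\<in>A. metric_tree (T a) (d a)) \<and>
           (\<forall>x\<in>cone_carrier Z. \<forall>a\<in>A. f x a \<in> T a) \<and>
           qi_embedding (cone_carrier Z) (cone_dist Z) (l2_prod_dist A d) f"
proof -
  obtain \<delta> t0 where \<delta>: "0 < \<delta>" "0 < t0"
    and fam: "\<And>\<tau>. 0 < \<tau> \<Longrightarrow> \<tau> \<le> t0 \<Longrightarrow> \<exists>\<W> :: nat \<Rightarrow> 'a set set.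
      (\<forall>a<Suc n. \<forall>V\<in>\<W> a. \<forall>x\<in>V. \<forall>y\<in>V. dist x y \<le> \<tau>) \<and>
      (\<forall>a<Suc n. \<forall>V\<in>\<W> a. \<forall>V'\<in>\<W> a. V \<noteq> V' \<longrightarrow> (\<forall>x\<in>V. \<forall>y\<in>V'. \<delta> * \<tau> < dist x y)) \<and>
      (\<forall>z\<in>Z. \<exists>a<Suc n. \<exists>V\<in>\<W> a. z \<in> V)"
    by (rule cdim_separated_families[OF assms]) (rule that)
  \<comment> \<open>The second bound turns the separation \<open>\<delta> * t i\<close> into the
    \<open>16 * r * t i\<close> required by \<open>hierarchy\<close>.\<close>
  define r where "r = min (1/12) (\<delta> / 16)"
  have r: "0 < r" "r \<le> 1/12" "16 * r \<le> \<delta>" using \<delta> by (auto simp: r_def)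
  define t where "t i = t0 * r ^ i" for i
  have t: "0 < t i" "t i \<le> t0" for i
    using r \<delta> by (auto simp: t_def power_le_one mult_le_cancel_left2)
  obtain W :: "nat \<Rightarrow> nat \<Rightarrow> 'a set set" where
    W: "\<And>i a V x y. a < Suc n \<Longrightarrow> V \<in> W i a \<Longrightarrow> x \<in> V \<Longrightarrow> y \<in> V \<Longrightarrow> dist x y \<le> t i"
      "\<And>i a V V' x y. a < Suc n \<Longrightarrow> V \<in> W i a \<Longrightarrow> V' \<in> W i a \<Longrightarrow> V \<noteq> V' \<Longrightarrow> x \<in> V \<Longrightarrow> y \<in> V' \<Longrightarrow> \<delta> * t i < dist x y"
      "\<And>i z. z \<in> Z \<Longrightarrow> \<exists>a<Suc n. \<exists>V\<in>W i a. z \<in> V"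
  proof -
    have "\<forall>i. \<exists>\<W> :: nat \<Rightarrow> 'a set set.
      (\<forall>a<Suc n. \<forall>V\<in>\<W> a. \<forall>x\<in>V. \<forall>y\<in>V. dist x y \<le> t i) \<and>
      (\<forall>a<Suc n. \<forall>V\<in>\<W> a. \<forall>V'\<in>\<W> a. V \<noteq> V' \<longrightarrow> (\<forall>x\<in>V. \<forall>y\<in>V'. \<delta> * t i < dist x y)) \<and>
      (\<forall>z\<in>Z. \<exists>a<Suc n. \<exists>V\<in>\<W> a. z \<in> V)"
      using fam[OF t] by blast
    from choice[OF this] obtain W :: "nat \<Rightarrow> nat \<Rightarrow> 'a set set" where
      *: "\<forall>i. (\<forall>a<Suc n. \<forall>V\<in>W i a. \<forall>x\<in>V. \<forall>y\<in>V. dist x y \<le> t i) \<and>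
      (\<forall>a<Suc n. \<forall>V\<in>W i a. \<forall>V'\<in>W i a. V \<noteq> V' \<longrightarrow> (\<forall>x\<in>V. \<forall>y\<in>V'. \<delta> * t i < dist x y)) \<and>
      (\<forall>z\<in>Z. \<exists>a<Suc n. \<exists>V\<in>W i a. z \<in> V)" ..
    show thesis
    proof (rule that[of W])
      show "dist x y \<le> t i" if "a < Suc n" "V \<in> W i a" "x \<in> V" "y \<in> V" for i a V x y
        using *[THEN spec, THEN conjunct1, rule_format, OF that] .
      show "\<delta> * t i < dist x y"
        if "a < Suc n" "V \<in> W i a" "V' \<in> W i a" "V \<noteq> V'" "x \<in> V" "y \<in> V'" for i a V V' x y
        using *[THEN spec, THEN conjunct2, THEN conjunct1, rule_format, OF that] .
      show "\<exists>a<Suc n. \<exists>V\<in>W i a. z \<in> V" if "z \<in> Z" for i z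
        using *[THEN spec, THEN conjunct2, THEN conjunct2, rule_format, OF that] .
    qed
  qed
  have "\<exists>T (d :: 'a \<times> real \<Rightarrow> 'a \<times> real \<Rightarrow> real) \<phi> L. coarse_tree (\<lambda>i. W i a) r t0 T d \<phi> L"
    if a: "a < Suc n" for a
  proof -
    interpret hierarchy "\<lambda>i. W i a" r t0
    proof
      fix i V V' x y assume V: "V \<in> W i a" "V' \<in> W i a" "V \<noteq> V'" "x \<in> V" "y \<in> V'"
      have "16 * r * t i \<le> \<delta> * t i" using r(3) t(1)[of i] by (intro mult_right_mono) auto
      with W(2)[OF a V] show "16 * r * (t0 * r ^ i) < dist x y" by (simp add: t_def)
    qed (use r \<delta> W(1)[OF a] in \<open>auto simp: t_def\<close>)
    show ?thesis by (rule coarse_tree_exists)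
  qed
  then obtain T and d :: "nat \<Rightarrow> 'a \<times> real \<Rightarrow> 'a \<times> real \<Rightarrow> real" and \<phi> L where
    ct: "\<And>a. a < Suc n \<Longrightarrow> coarse_tree (\<lambda>i. W i a) r t0 (T a) (d a) (\<phi> a) (L a)"
    by metis
  define A where "A = {..<Suc n}"
  \<comment> \<open>With \<open>exp (- l) = r\<close>, moving out by \<open>l\<close> in the cone
    corresponds to passing to the next scale; \<open>K s\<close> is the level reached at radius
    \<open>s\<close>.\<close>
  define l where "l = ln (1 / r)"
  define K where "K s = nat \<lfloor>s / l\<rfloor>" for s :: real
  define f where "f x a = \<phi> a (fst x) (K (snd x))" for x a
  have l: "1 \<le> l"
  proof -
    have "12 \<le> 1 / r" using r by (simp add: field_simps)
    then have "exp 1 \<le> 1 / r" using exp_le by linarith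
    then show ?thesis unfolding l_def using r by (simp add: ln_ge_iff)
  qed
  have exp_l: "exp (- l * real m) = r ^ m" for m
  proof -
    have "exp (- l * real m) = exp (- l) ^ m" by (metis exp_of_nat_mult mult.commute)
    also have "exp (- l) = r" using r by (simp add: l_def ln_div)
    finally show ?thesis .
  qed
  have K: "l * K s \<le> s" "s \<le> l * (K s + 1)" if "0 \<le> s" for s
  proof -
    have "0 \<le> \<lfloor>s / l\<rfloor>" using that l by simp
    then have "real (K s) = of_int \<lfloor>s / l\<rfloor>" by (simp add: K_def)
    then have "K s \<le> s / l" "s / l \<le> K s + 1" by linarith+
    then show "l * K s \<le> s" "s \<le> l * (K s + 1)" using l by (simp_all add: field_simps)
  qed
  have tree: "metric_tree (T a) (d a)" "\<phi> a z k \<in> T a" if "a \<in> A" for a z k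
    using coarse_treeD(1,2)[OF ct] that by (auto simp: A_def)
  have d: "0 \<le> d a u v" "d a u v = d a v u" if "a \<in> A" for a u v
    using tree(1)[OF that] Metric_space.nonneg Metric_space.commute unfolding metric_tree_def by metis+

  \<comment> \<open>Comparison of cone and tree distances with the level count\<close>
  define \<mu> where "\<mu> = pi / diameter Z"
  \<comment> \<open>For distinct points the angle lies between \<open>c1 * r ^ m\<close> and
    \<open>c2 * r ^ m\<close>, where \<open>m\<close> is the level of divergence; the diameter is
    needed at \<open>m = 0\<close>. If \<open>diameter Z = 0\<close>, then \<open>\<mu> = 0\<close>
    and only the case \<open>z = z'\<close> occurs, which just uses
    \<open>l \<le> C\<close>.\<close>
  define c1 where "c1 = \<mu> * (r * t0)"
  define c2 where "c2 = \<mu> * max t0 (diameter Z)"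
  define C where "C = 2 * l + ln (2 * (1 + c2\<^sup>2)) + ln 2 + \<bar>ln (c1\<^sup>2 / 288)\<bar>"
  have C: "l \<le> C"
  proof -
    have "0 \<le> ln (2::real)" "0 \<le> ln (2 * (1 + c2\<^sup>2))" by (auto intro!: ln_ge_zero simp: add_increasing2)
    then show ?thesis using l unfolding C_def by linarith
  qed
  have ordered: "\<exists>N\<ge>0. \<bar>cone_dist Z (z, s) (z', s') - l * N\<bar> \<le> C \<and>
      (\<forall>a\<in>A. d a (f (z, s) a) (f (z', s') a) \<le> N + 2) \<and>
      N / 2 - 2 * real (Suc n) \<le> (\<Sum>a\<in>A. d a (f (z, s) a) (f (z', s') a))"
    if z: "z \<in> Z" "z' \<in> Z" and s: "0 \<le> s" "0 \<le> s'" and KK: "K s' \<le> K s" for z z' s s'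
  proof -
    obtain m where m: "\<forall>j<min (K s') m. dist z z' \<le> r * (t0 * r ^ j)"
      "m < K s' \<longrightarrow> 2 * (t0 * r ^ (m + 2)) < dist z z'"
      "\<bar>cone_dist Z (z, s) (z', s') - l * (real (K s) + real (K s') - 2 * real (min (K s') m))\<bar> \<le> C"
    proof (cases "z = z'")
      case True
      have "\<bar>cone_dist Z (z, s) (z', s') - l * (real (K s) + real (K s') - 2 * real (min (K s') (K s')))\<bar> \<le> C"
      proof -
        have "l * real (K s') \<le> l * real (K s)" using KK l by simp
        then have "\<bar>\<bar>s - s'\<bar> - (l * real (K s) - l * real (K s'))\<bar> \<le> l"
          using K[OF s(1)] K[OF s(2)] by (simp add: distrib_left)
        then show ?thesis using C True by (simp add: cone_dist_same[OF s] algebra_simps)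
      qed
      \<comment> \<open>Equal rays never diverge, so the shorter length serves as
        \<open>m\<close>.\<close>
      then show thesis using that[of "K s'"] True r \<delta> by simp
    next
      case False
      have "t \<longlonglongrightarrow> t0 * 0"
        unfolding t_def using r by (intro tendsto_intros LIMSEQ_realpow_zero) auto
      then have "(\<lambda>j. r * t j) \<longlonglongrightarrow> r * (t0 * 0)" by (intro tendsto_intros)
      then have "\<forall>\<^sub>F j in sequentially. r * t j < dist z z'"
        by (rule order_tendstoD(2)) (use False in simp)
      then have ex: "\<exists>j. r * t j < dist z z'" using eventually_happens'[OF sequentially_bot] by blast
      \<comment> \<open>Minimality gives closeness at all earlier levels, and
        \<open>r * t m < dist z z'\<close> leaves the factor \<open>r\<close> that absorbs the 2 in
        \<open>2 * t (m + 2)\<close>.\<close>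
      define m where "m = (LEAST j. r * t j < dist z z')"
      have m1: "r * t m < dist z z'" unfolding m_def by (rule LeastI_ex[OF ex])
      have m2: "dist z z' \<le> r * t j" if "j < m" for j
        using not_less_Least[of j "\<lambda>j. r * t j < dist z z'"] that unfolding m_def by simp
      have diam: "dist z z' \<le> diameter Z" by (rule diameter_bounded_bound[OF assms(1) z])
      have pos: "0 < dist z z'" "0 < diameter Z" using False diam by (auto intro: less_le_trans[of 0 "dist z z'"])
      then have \<mu>: "0 < \<mu>" by (simp add: \<mu>_def)
      have \<theta>: "cone_angle Z z z' = \<mu> * dist z z'" using pos by (simp add: cone_angle_def \<mu>_def)
      have "2 * t (m + 2) < dist z z'"
      proof -
        have "2 * t (m + 2) = 2 * r * (r * t m)" by (simp add: t_def power2_eq_square)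
        also have "\<dots> \<le> 1 * (r * t m)" using r t(1)[of m] by (intro mult_right_mono) auto
        finally show ?thesis using m1 by simp
      qed
      moreover have "\<bar>cone_dist Z (z, s) (z', s') - l * (real (K s) + real (K s') - 2 * real (min (K s') m))\<bar> \<le> C"
        unfolding C_def
      proof (rule hyperbolic_side_estimate[OF l K[OF s(1)] K[OF s(2)], of "cone_angle Z z z'"])
        show "0 \<le> cone_angle Z z z'" using \<mu> by (simp add: \<theta>)
        show "cone_angle Z z z' \<le> pi"
          using diam pos by (simp add: \<theta> \<mu>_def field_simps)
        show "c1 * exp (- l * real m) \<le> cone_angle Z z z'"
          using mult_left_mono[OF less_imp_le[OF m1], of \<mu>] \<mu> unfolding exp_l \<theta> c1_def
          by (simp add: t_def mult.assoc)
        have "dist z z' \<le> max t0 (diameter Z) * r ^ m"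
        proof (cases m)
          case 0
          then show ?thesis using diam by simp
        next
          case (Suc j)
          then have "dist z z' \<le> t0 * r ^ m" using m2[of j] by (simp add: t_def mult.left_commute)
          also have "\<dots> \<le> max t0 (diameter Z) * r ^ m" using r by (intro mult_right_mono) auto
          finally show ?thesis .
        qed
        then show "cone_angle Z z z' \<le> c2 * exp (- l * real m)"
          using \<mu> unfolding exp_l \<theta> c2_def mult.assoc by (intro mult_left_mono) auto
        show "0 < c1" using \<mu> r \<delta> by (simp add: c1_def)
        show "min (K s') m = min (min (K s) (K s')) m" using KK by simp
      qed (rule cosh_cone_dist[OF s])+
      ultimately show thesis using that[of m] m2 by (simp add: t_def)
    qed
    define p where "p = min (K s') m"
    have p: "p \<le> K s" "p \<le> K s'" using KK by (auto simp: p_def)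
    define N where "N = real (K s) + real (K s') - 2 * real p"
    have "d a (f (z, s) a) (f (z', s') a) \<le> N + 2" if "a \<in> A" for a
      using coarse_treeD(4)[OF ct p, of a z z'] m(1) that
      unfolding A_def N_def f_def p_def by simp
    moreover have "N / 2 - 2 * real (Suc n) \<le> (\<Sum>a\<in>A. d a (f (z, s) a) (f (z', s') a))"
    proof -
      have "\<exists>a\<in>A. j \<in> L a z" for j
      proof -
        obtain a V where "a < Suc n" "V \<in> W j a" "z \<in> V" using W(3)[OF z(1)] by blast
        then show ?thesis using coarse_treeD(3)[OF ct] unfolding A_def by blast
      qed
      then have "K s - p \<le> (\<Sum>a\<in>A. card (L a z \<inter> {p..<K s}))"
        by (intro sum_card_cover) (auto simp: A_def)
      then have "real (K s) - real p \<le> (\<Sum>a\<in>A. real (card (L a z \<inter> {p..<K s})))"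
        unfolding of_nat_sum[symmetric] by linarith
      \<comment> \<open>This is where \<open>K s' \<le> K s\<close> enters: the longer ray carries
        at least half of \<open>N\<close>.\<close>
      moreover have "N / 2 \<le> real (K s) - real p" using KK p unfolding N_def by simp
      moreover have "(\<Sum>a\<in>A. real (card (L a z \<inter> {p..<K s})) - 2) \<le> (\<Sum>a\<in>A. d a (f (z, s) a) (f (z', s') a))"
      proof (rule sum_mono)
        fix a assume "a \<in> A"
        then show "real (card (L a z \<inter> {p..<K s})) - 2 \<le> d a (f (z, s) a) (f (z', s') a)"
          using coarse_treeD(5)[OF ct _ m(1,2)] p(1) unfolding A_def f_def p_def by simp
      qed
      ultimately show ?thesis by (simp add: sum_subtractf A_def)
    qed
    moreover have "0 \<le> N" using p unfolding N_def by simp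
    ultimately show ?thesis using m(3) unfolding p_def[symmetric] N_def[symmetric] by blast
  qed
  have core: "\<exists>N\<ge>0. \<bar>cone_dist Z x x' - l * N\<bar> \<le> C \<and> (\<forall>a\<in>A. d a (f x a) (f x' a) \<le> N + 2) \<and>
      N / 2 - 2 * real (Suc n) \<le> (\<Sum>a\<in>A. d a (f x a) (f x' a))"
    if carrier: "x \<in> cone_carrier Z" "x' \<in> cone_carrier Z" for x x'
  proof -
    obtain z s z' s' where x: "x = (z, s)" "x' = (z', s')" "z \<in> Z" "z' \<in> Z" "0 \<le> s" "0 \<le> s'"
      using carrier by (auto simp: cone_carrier_def)
    show ?thesis
    proof (cases "K s' \<le> K s")
      case True
      then show ?thesis using ordered[of z z' s s'] x by simp
    next
      case False
      then have "\<exists>N\<ge>0. \<bar>cone_dist Z x' x - l * N\<bar> \<le> C \<and> (\<forall>a\<in>A. d a (f x' a) (f x a) \<le> N + 2) \<and>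
          N / 2 - 2 * real (Suc n) \<le> (\<Sum>a\<in>A. d a (f x' a) (f x a))"
        using ordered[of z' z s' s] x by simp
      moreover have "d a (f x' a) (f x a) = d a (f x a) (f x' a)" if "a \<in> A" for a
        using d(2)[OF that] .
      moreover from this have "(\<Sum>a\<in>A. d a (f x' a) (f x a)) = (\<Sum>a\<in>A. d a (f x a) (f x' a))"
        by (intro sum.cong) auto
      ultimately show ?thesis by (simp add: cone_dist_commute[of Z x' x])
    qed
  qed
  define M where "M = real (Suc n)"
  have M: "1 \<le> M" by (simp add: M_def)
  \<comment> \<open>From \<open>D \<le> l * N + C\<close> and
    \<open>N / 2 - 2 * M \<le> M * L2_set e A\<close> one gets
    \<open>D \<le> \<Lambda> * L2_set e A + C + 2 * \<Lambda>\<close>; the choice of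
    \<open>\<sigma>\<close> covers the rest, and also the error in the upper bound
    \<open>M * (D + C + 2)\<close>.\<close>
  define \<Lambda> where "\<Lambda> = 2 * M * l"
  define \<sigma> where "\<sigma> = M * (C + 2)"
  have \<Lambda>: "M \<le> \<Lambda>" "1 \<le> \<Lambda>"
  proof -
    have "M * 1 \<le> M * (2 * l)" using M l by (intro mult_left_mono) auto
    also have "M * (2 * l) = \<Lambda>" by (simp add: \<Lambda>_def)
    finally show "M \<le> \<Lambda>" "1 \<le> \<Lambda>" using M by simp_all
  qed
  have \<sigma>: "C + 2 \<le> \<sigma>" using mult_right_mono[OF M, of "C + 2"] C l by (simp add: \<sigma>_def)
  have "qi_embedding (cone_carrier Z) (cone_dist Z) (l2_prod_dist A d) f"
    unfolding qi_embedding_def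
  proof (rule exI[of _ \<Lambda>], rule exI[of _ \<sigma>], intro conjI ballI)
    show "1 \<le> \<Lambda>" "0 \<le> \<sigma>" using \<Lambda> \<sigma> C l by auto
    fix x x' assume x: "x \<in> cone_carrier Z" "x' \<in> cone_carrier Z"
    define D where "D = cone_dist Z x x'"
    define e where "e a = d a (f x a) (f x' a)" for a
    have l2: "l2_prod_dist A d (f x) (f x') = L2_set e A"
      by (simp add: l2_prod_dist_def L2_set_def e_def)
    obtain N where N: "0 \<le> N" "\<bar>D - l * N\<bar> \<le> C" "\<And>a. a \<in> A \<Longrightarrow> e a \<le> N + 2" "N / 2 - 2 * M \<le> sum e A"
      using core[OF x] unfolding D_def e_def M_def by blast
    have fin: "finite A" and card: "real (card A) = M" by (simp_all add: A_def M_def)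
    have "D \<ge> 0"
      using x cosh_cone_dist(2) unfolding D_def cone_carrier_def by (metis atLeast_iff mem_Sigma_iff prod.exhaust)
    have lN: "N \<le> l * N" using mult_right_mono[OF l N(1)] by simp
    have "L2_set e A \<le> sum e A" by (rule L2_set_le_sum) (simp add: e_def d)
    also have "\<dots> \<le> M * (N + 2)" using sum_bounded_above[of A e "N + 2"] N(3) card by simp
    also have "\<dots> \<le> M * (D + C + 2)" using lN N(2) M by (intro mult_left_mono) auto
    also have "\<dots> \<le> \<Lambda> * D + \<sigma>"
      using mult_right_mono[OF \<Lambda>(1) \<open>0 \<le> D\<close>] by (simp add: \<sigma>_def algebra_simps)
    finally show "l2_prod_dist A d (f x) (f x') \<le> \<Lambda> * cone_dist Z x x' + \<sigma>"
      unfolding l2 D_def .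
    \<comment> \<open>Each coordinate is at most the \<open>L2_set\<close> norm, and there are
      \<open>M\<close> of them.\<close>
    have "sum e A \<le> M * L2_set e A"
      using sum_bounded_above[of A e "L2_set e A"] member_le_L2_set[OF fin, of _ e] card by simp
    then have "N / 2 - 2 * M \<le> M * L2_set e A" using N(4) by linarith
    then have "l * (N / 2 - 2 * M) \<le> l * (M * L2_set e A)" using l by (intro mult_left_mono) auto
    then have "D - C - 4 * M * l \<le> \<Lambda> * L2_set e A" using N(2) by (simp add: \<Lambda>_def algebra_simps abs_le_iff)
    then have "D - C - 2 * \<Lambda> \<le> \<Lambda> * L2_set e A" by (simp add: \<Lambda>_def algebra_simps)
    moreover have "C + 2 * \<Lambda> \<le> \<Lambda> * \<sigma>"
    proof -
      have "C \<le> \<Lambda> * C" using mult_right_mono[OF \<Lambda>(2), of C] C l by simp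
      moreover have "\<Lambda> * (C + 2) \<le> \<Lambda> * \<sigma>" using \<sigma> \<Lambda> by (intro mult_left_mono) auto
      ultimately show ?thesis by (simp add: algebra_simps)
    qed
    ultimately have "D \<le> \<Lambda> * (L2_set e A + \<sigma>)" by (simp add: distrib_left)
    then have "D / \<Lambda> \<le> L2_set e A + \<sigma>" using \<Lambda> by (simp add: divide_le_eq mult.commute)
    then show "cone_dist Z x x' / \<Lambda> - \<sigma> \<le> l2_prod_dist A d (f x) (f x')"
      unfolding l2 D_def by simp
  qed
  moreover have "finite A" "card A = n + 1" by (simp_all add: A_def)
  moreover have "f x a \<in> T a" if "a \<in> A" for x a using tree(2)[OF that] by (simp add: f_def)
  ultimately show ?thesis using tree(1) by blast
qed

end
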